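(* Every non-complete graph $H$ on at most six vertices is deletion-normal.
   Context: All graphs are finite, without loops or parallel edges. A graph $G$ is $H$-free if it has no induced subgraph isomorphic to $H$. A graph $G$ is $H$-deletion-saturated if $G$ is $H$-free, $E(G)\neq\varnothing$, and for every edge $e\in E(G)$ the graph $G-e$ (obtained by deleting $e$) is not $H$-free. A graph $H$ is deletion-normal if there exists a (finite) $H$-deletion-saturated graph. A graph is complete if every two distinct vertices are adjacent. *)

theory Defs
  imports Main
begin

text \<open>Undirected graphs; an edge is the set of its two end vertices.\<close>

record 'a ugraph =
  vertices :: "'a set"
  edges :: "'a set set"

definition simple_graph :: "'a ugraph \<Rightarrow> bool" where
  "simple_graph G \<longleftrightarrow>
     finite (vertices G) \<and> (\<forall>e\<in>edges G. e \<subseteq> vertices G \<and> card e = 2)"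

definition complete_graph :: "'a ugraph \<Rightarrow> bool" where
  "complete_graph G \<longleftrightarrow>
     (\<forall>u\<in>vertices G. \<forall>v\<in>vertices G. u \<noteq> v \<longrightarrow> {u, v} \<in> edges G)"

definition induced_subgraph :: "'a ugraph \<Rightarrow> 'a set \<Rightarrow> 'a ugraph" where
  "induced_subgraph G S = \<lparr>vertices = S, edges = {e \<in> edges G. e \<subseteq> S}\<rparr>"

definition isomorphic :: "'a ugraph \<Rightarrow> 'b ugraph \<Rightarrow> bool" where
  "isomorphic G H \<longleftrightarrow>
     (\<exists>f. bij_betw f (vertices G) (vertices H) \<and>
        (\<forall>u\<in>vertices G. \<forall>v\<in>vertices G. {u, v} \<in> edges G \<longleftrightarrow> {f u, f v} \<in> edges H))"

definition induced_free :: "'a ugraph \<Rightarrow> 'b ugraph \<Rightarrow> bool" where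
  "induced_free H G \<longleftrightarrow>
     \<not> (\<exists>S\<subseteq>vertices G. isomorphic (induced_subgraph G S) H)"

definition delete_edge :: "'a ugraph \<Rightarrow> 'a set \<Rightarrow> 'a ugraph" where
  "delete_edge G e = \<lparr>vertices = vertices G, edges = edges G - {e}\<rparr>"

definition deletion_saturated :: "'a ugraph \<Rightarrow> 'b ugraph \<Rightarrow> bool" where
  "deletion_saturated H G \<longleftrightarrow>
     simple_graph G \<and> induced_free H G \<and> edges G \<noteq> {} \<and>
     (\<forall>e\<in>edges G. \<not> induced_free H (delete_edge G e))"

text \<open>
  The saturated graph is sought among graphs on natural numbers. As it is finite and
  saturation is invariant under isomorphism, this loses no generality; it avoids tying
  its vertices to the type of the vertices of the forbidden graph, which may be finite.
\<close>

definition deletion_normal :: "'a ugraph \<Rightarrow> bool" where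
  "deletion_normal H \<longleftrightarrow> (\<exists>G :: nat ugraph. deletion_saturated H G)"

end

theory Submission
  imports Defs
begin

text \<open>
  Whether \<open>H\<close> is deletion-normal depends only on its isomorphism type. There are 202 types of
  non-complete graphs on at most six vertices, and for each of them a saturated graph, its host,
  is exhibited. This needs a criterion for saturation that is cheap to check, a list of graphs that
  meet it, and the fact that the list misses no isomorphism type.

  \<^bold>\<open>The criterion.\<close> Suppose that \<open>G\<close> is \<open>H\<close>-free while \<open>G - ab\<close> contains an induced copy of \<open>H\<close>.
  The copy must use both \<open>a\<close> and \<open>b\<close>, as two non-adjacent vertices, and so with the edge \<open>ab\<close> present
  it is an induced copy in \<open>G\<close> of a graph \<open>k\<close> that arises from \<open>H\<close> by joining two vertices. It is
  therefore natural to start from \<open>k\<close> with a distinguished root edge, and to take for \<open>H\<close> the graph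
  \<open>cut k\<close> obtained by removing the root edge. A graph \<open>G\<close> with an edge is saturated for \<open>cut k\<close> as
  soon as it is \<open>cut k\<close>-free and each of its edges is the root edge of an induced copy of \<open>k\<close>
  (\<open>host_saturated\<close>). Both conditions concern induced subgraphs of the one graph \<open>G\<close>. If \<open>G\<close> is
  edge-transitive, the second one only asks that \<open>k\<close> occurs at all; this is why very symmetric
  graphs are good hosts. The line graphs of \<open>K\<^sub>5\<close> and \<open>K\<^sub>6\<close> and the Paley graph of order 13
  account for 86 of the 202 types, and 29 hosts suffice for all of them.

  \<^bold>\<open>The check.\<close> Induced copies are found or excluded by backtracking: the vertices of the pattern are
  placed one after the other, each vertex still to be placed carries the set of positions that the
  earlier choices have left to it, and a branch is abandoned once one of these sets is empty.
  The correctness of this search is \<open>search_iff\<close>.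

  \<^bold>\<open>Completeness of the list.\<close> A graph on \<open>n + 1\<close> vertices is a graph on \<open>n\<close> vertices with a vertex
  added. So the complete graphs and the graphs \<open>cut k\<close> exhaust the graphs on one to six vertices up
  to isomorphism if each way to add a vertex to one with at most five vertices gives a graph
  isomorphic to one of them (\<open>closed_represents\<close>).
\<close>

section \<open>Graphs given by upper triangular matrices\<close>

text \<open>
  A graph on the vertices \<open>0, \<dots>, n - 1\<close> is coded by the part of its adjacency matrix above the
  diagonal. In \<open>r # c\<close> the row \<open>r\<close> says to which later vertices the vertex \<open>0\<close> is joined, and \<open>c\<close> is
  the graph on the later vertices, renumbered from \<open>0\<close>. Adding a vertex to a graph is therefore
  \<open>Cons\<close>, and a search that places the vertices of a pattern in turn recurses over its code.
\<close>

type_synonym code = "bool list list"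

fun well_formed :: "code \<Rightarrow> bool" where
  "well_formed [] = True"
| "well_formed (r # c) = (length r = length c \<and> well_formed c)"

fun adj :: "code \<Rightarrow> nat \<Rightarrow> nat \<Rightarrow> bool" where
  "adj [] i j = False"
| "adj (r # c) 0 0 = False"
| "adj (r # c) 0 (Suc j) = r ! j"
| "adj (r # c) (Suc i) 0 = r ! i"
| "adj (r # c) (Suc i) (Suc j) = adj c i j"

definition graph_of :: "code \<Rightarrow> nat ugraph" where
  "graph_of c = \<lparr>vertices = {..<length c},
     edges = {{i, j} | i j. i < length c \<and> j < length c \<and> adj c i j}\<rparr>"

lemma adj_commute: "adj c i j = adj c j i"
  by (induction c i j rule: adj.induct) auto

lemma adj_irrefl [simp]: "\<not> adj c i i"
proof (induction c arbitrary: i)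
  case (Cons r c)
  then show ?case by (cases i) auto
qed simp

lemma vertices_graph_of [simp]: "vertices (graph_of c) = {..<length c}"
  by (simp add: graph_of_def)

lemma edge_graph_of_iff:
  assumes "i < length c" "j < length c"
  shows "{i, j} \<in> edges (graph_of c) \<longleftrightarrow> adj c i j"
  using assms by (auto simp: graph_of_def doubleton_eq_iff adj_commute)

lemma edges_graph_of_cases:
  assumes "e \<in> edges (graph_of c)"
  obtains i j where "e = {i, j}" "i < j" "j < length c" "adj c i j"
proof -
  from assms obtain i j where ij: "e = {i, j}" "i < length c" "j < length c" "adj c i j"
    by (auto simp: graph_of_def)
  then have "i \<noteq> j" by auto
  then show thesis
    using ij that[of i j] that[of j i] by (metis adj_commute insert_commute nat_neq_iff)
qed

lemma simple_graph_of: "simple_graph (graph_of c)"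
  unfolding simple_graph_def
proof (intro conjI ballI)
  fix e assume "e \<in> edges (graph_of c)"
  then obtain i j where "e = {i, j}" "i < j" "j < length c"
    by (rule edges_graph_of_cases)
  then show "e \<subseteq> vertices (graph_of c)" "card e = 2"
    by auto
qed simp

section \<open>Induced copies\<close>

text \<open>
  An induced copy is given as a list, so that its \<open>i\<close>-th entry is the image of the vertex \<open>i\<close>.
\<close>

definition copy_at :: "code \<Rightarrow> 'a ugraph \<Rightarrow> 'a list \<Rightarrow> bool" where
  "copy_at c G xs \<longleftrightarrow> length xs = length c \<and> distinct xs \<and> set xs \<subseteq> vertices G \<and>
     (\<forall>i<length c. \<forall>j<length c. {xs ! i, xs ! j} \<in> edges G \<longleftrightarrow> adj c i j)"

lemma not_induced_free_iff_copy:
  "\<not> induced_free (graph_of c) G \<longleftrightarrow> (\<exists>xs. copy_at c G xs)"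
proof
  assume "\<not> induced_free (graph_of c) G"
  then obtain S f where S: "S \<subseteq> vertices G" and f: "bij_betw f S {..<length c}"
    and E: "\<And>u v. u \<in> S \<Longrightarrow> v \<in> S \<Longrightarrow>
              {u, v} \<in> edges G \<longleftrightarrow> {f u, f v} \<in> edges (graph_of c)"
    by (auto simp: induced_free_def isomorphic_def induced_subgraph_def)
  define h where "h = inv_into S f"
  have h: "bij_betw h {..<length c} S"
    unfolding h_def by (rule bij_betw_inv_into[OF f])
  have fh: "f (h i) = i" if "i < length c" for i
    using that f unfolding h_def by (simp add: bij_betw_inv_into_right)
  have hS: "h i \<in> S" if "i < length c" for i
    using that h by (auto simp: bij_betw_def)
  have "copy_at c G (map h [0..<length c])"
    unfolding copy_at_def
  proof (intro conjI allI impI)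
    show "distinct (map h [0..<length c])"
      using h by (simp add: distinct_map bij_betw_def atLeast0LessThan)
    show "set (map h [0..<length c]) \<subseteq> vertices G"
      using hS S by auto
    fix i j assume "i < length c" "j < length c"
    then show "{map h [0..<length c] ! i, map h [0..<length c] ! j} \<in> edges G \<longleftrightarrow> adj c i j"
      using E[OF hS hS, of i j] by (simp add: fh edge_graph_of_iff)
  qed simp
  then show "\<exists>xs. copy_at c G xs" ..
next
  assume "\<exists>xs. copy_at c G xs"
  then obtain xs where xs: "copy_at c G xs" ..
  define h where "h = (\<lambda>i. xs ! i)"
  have h: "bij_betw h {..<length c} (set xs)"
    using xs unfolding h_def copy_at_def by (intro bij_betw_nth) auto
  define f where "f = inv_into {..<length c} h"
  have f: "bij_betw f (set xs) {..<length c}"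
    unfolding f_def by (rule bij_betw_inv_into[OF h])
  have "isomorphic (induced_subgraph G (set xs)) (graph_of c)"
    unfolding isomorphic_def
  proof (intro exI[of _ f] conjI ballI)
    show "bij_betw f (vertices (induced_subgraph G (set xs))) (vertices (graph_of c))"
      using f by (simp add: induced_subgraph_def)
    fix u v
    assume "u \<in> vertices (induced_subgraph G (set xs))" "v \<in> vertices (induced_subgraph G (set xs))"
    then have "u \<in> h ` {..<length c}" "v \<in> h ` {..<length c}"
      using h by (simp_all add: induced_subgraph_def bij_betw_def)
    then obtain i j where ij: "i < length c" "j < length c" "u = h i" "v = h j"
      by auto
    have fh: "f (h k) = k" if "k < length c" for k
      using h that unfolding f_def by (simp add: bij_betw_inv_into_left)
    have "h i \<in> set xs" "h j \<in> set xs" using ij h by (auto simp: bij_betw_def)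
    then show "{u, v} \<in> edges (induced_subgraph G (set xs)) \<longleftrightarrow> {f u, f v} \<in> edges (graph_of c)"
      using xs ij by (simp add: induced_subgraph_def fh edge_graph_of_iff copy_at_def flip: h_def)
  qed
  moreover have "set xs \<subseteq> vertices G" using xs by (simp add: copy_at_def)
  ultimately show "\<not> induced_free (graph_of c) G"
    unfolding induced_free_def by blast
qed

lemma isomorphic_trans:
  assumes "isomorphic G H" "isomorphic H K"
  shows "isomorphic G K"
proof -
  obtain f where f: "bij_betw f (vertices G) (vertices H)"
    "\<And>u v. u \<in> vertices G \<Longrightarrow> v \<in> vertices G \<Longrightarrow> {u, v} \<in> edges G \<longleftrightarrow> {f u, f v} \<in> edges H"
    using assms(1) unfolding isomorphic_def by blast
  obtain h where h: "bij_betw h (vertices H) (vertices K)"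
    "\<And>u v. u \<in> vertices H \<Longrightarrow> v \<in> vertices H \<Longrightarrow> {u, v} \<in> edges H \<longleftrightarrow> {h u, h v} \<in> edges K"
    using assms(2) unfolding isomorphic_def by blast
  have "f u \<in> vertices H" if "u \<in> vertices G" for u
    using f(1) that by (auto simp: bij_betw_def)
  then show ?thesis
    unfolding isomorphic_def using bij_betw_trans[OF f(1) h(1)] f(2) h(2)
    by (intro exI[of _ "h \<circ> f"]) simp
qed

lemma isomorphic_sym:
  assumes "isomorphic G H"
  shows "isomorphic H G"
proof -
  obtain f where f: "bij_betw f (vertices G) (vertices H)"
    "\<And>u v. u \<in> vertices G \<Longrightarrow> v \<in> vertices G \<Longrightarrow> {u, v} \<in> edges G \<longleftrightarrow> {f u, f v} \<in> edges H"
    using assms unfolding isomorphic_def by blast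
  define h where "h = inv_into (vertices G) f"
  have h: "bij_betw h (vertices H) (vertices G)"
    unfolding h_def by (rule bij_betw_inv_into[OF f(1)])
  have "h u \<in> vertices G" "f (h u) = u" if "u \<in> vertices H" for u
    using h f(1) that unfolding h_def by (auto simp: bij_betw_def f_inv_into_f)
  then show ?thesis
    unfolding isomorphic_def using h f(2) by (intro exI[of _ h]) simp
qed

lemma deletion_saturated_isomorphic:
  fixes G :: "'c ugraph"
  assumes "isomorphic H H'" "deletion_saturated H' G"
  shows "deletion_saturated H G"
proof -
  have "isomorphic K H \<longleftrightarrow> isomorphic K H'" for K :: "'c ugraph"
    using isomorphic_trans[of K H H'] isomorphic_trans[of K H' H] assms(1)
      isomorphic_sym[of H H'] by blast
  then have "induced_free H K \<longleftrightarrow> induced_free H' K" for K :: "'c ugraph"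
    by (simp add: induced_free_def)
  then show ?thesis using assms(2) by (simp add: deletion_saturated_def)
qed

lemma copy_spanning_isomorphic:
  assumes "copy_at c (graph_of d) xs" "length c = length d"
  shows "isomorphic (graph_of d) (graph_of c)"
proof -
  define h where "h = (\<lambda>i. xs ! i)"
  have "set xs = {..<length d}"
    using assms unfolding copy_at_def
    by (intro card_subset_eq) (auto simp: distinct_card)
  then have "bij_betw h {..<length c} {..<length d}"
    using assms unfolding h_def copy_at_def by (intro bij_betw_nth) auto
  moreover have "{i, j} \<in> edges (graph_of c) \<longleftrightarrow> {h i, h j} \<in> edges (graph_of d)"
    if "i < length c" "j < length c" for i j
    using assms(1) that by (simp add: copy_at_def h_def edge_graph_of_iff)
  ultimately have "isomorphic (graph_of c) (graph_of d)"
    unfolding isomorphic_def by (intro exI[of _ h]) auto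
  then show ?thesis by (rule isomorphic_sym)
qed

section \<open>Searching for copies\<close>

text \<open>
  The row of a vertex consists of the characteristic lists of its neighbours and of its
  non-neighbours. The vertex itself is in neither of them; this makes the places chosen for
  two vertices of a pattern distinct whether or not these vertices are adjacent.
\<close>

type_synonym row = "bool list \<times> bool list"

fun attach :: "bool list \<Rightarrow> row list \<Rightarrow> row list" where
  "attach (b # r) ((p, q) # M) = (b # p, (\<not> b) # q) # attach r M"
| "attach _ _ = []"

fun rows :: "code \<Rightarrow> row list" where
  "rows [] = []"
| "rows (r # c) = (False # r, False # map Not r) # attach r (rows c)"

definition side :: "bool \<Rightarrow> row \<Rightarrow> bool list" where
  "side b m = (if b then fst m else snd m)"

lemma length_attach: "length (attach r M) = min (length r) (length M)"
  by (induction r M rule: attach.induct) auto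

lemma nth_attach:
  "\<lbrakk>i < length r; i < length M\<rbrakk> \<Longrightarrow>
    attach r M ! i = (r ! i # fst (M ! i), (\<not> r ! i) # snd (M ! i))"
  by (induction r M arbitrary: i rule: attach.induct) (auto simp: nth_Cons split: nat.split)

lemma length_rows [simp]: "well_formed c \<Longrightarrow> length (rows c) = length c"
  by (induction c) (auto simp: length_attach)

lemma length_side_rows:
  "\<lbrakk>well_formed c; i < length c\<rbrakk> \<Longrightarrow> length (side b (rows c ! i)) = length c"
proof (induction c arbitrary: i)
  case (Cons r c)
  then show ?case by (cases i) (auto simp: side_def nth_attach)
qed simp

lemma nth_side_rows:
  "\<lbrakk>well_formed c; i < length c; j < length c\<rbrakk> \<Longrightarrow>
    side b (rows c ! i) ! j \<longleftrightarrow> i \<noteq> j \<and> adj c i j = b"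
proof (induction c arbitrary: i j)
  case (Cons r c)
  show ?case
  proof (cases i)
    case 0
    then show ?thesis using Cons.prems by (cases j) (auto simp: side_def)
  next
    case (Suc i')
    then show ?thesis
      using Cons.prems Cons.IH[of i' "j - 1"] by (cases j) (auto simp: side_def nth_attach)
  qed
qed simp

text \<open>
  What it means to be a copy in terms of rows, one vertex of the pattern after the other: this is
  the form in which the search meets copies.
\<close>

fun places :: "row list \<Rightarrow> code \<Rightarrow> nat list \<Rightarrow> bool" where
  "places M [] [] = True"
| "places M (r # c) (x # xs) =
     (x < length M \<and> list_all2 (\<lambda>b y. side b (M ! x) ! y) r xs \<and> places M c xs)"
| "places M _ _ = False"

lemma places_imp: "places M c xs \<Longrightarrow> length xs = length c \<and> set xs \<subseteq> {..<length M}"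
  by (induction M c xs rule: places.induct) auto

lemma places_rows_iff:
  assumes "well_formed g" "well_formed c"
  shows "places (rows g) c xs \<longleftrightarrow> copy_at c (graph_of g) xs"
  using assms(2)
proof (induction c arbitrary: xs)
  case Nil
  then show ?case by (cases xs) (auto simp: copy_at_def)
next
  case (Cons r c)
  show ?case
  proof (cases xs)
    case Nil
    then show ?thesis by (simp add: copy_at_def)
  next
    case (Cons x ys)
    have IH: "places (rows g) c ys \<longleftrightarrow> copy_at c (graph_of g) ys"
      using Cons.IH Cons.prems by simp
    have row: "list_all2 (\<lambda>b y. side b (rows g ! x) ! y) r ys \<longleftrightarrow>
                 (\<forall>i<length c. x \<noteq> ys ! i \<and> adj g x (ys ! i) = r ! i)"
      if "x < length g" "length ys = length c" "set ys \<subseteq> {..<length g}"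
      using that Cons.prems assms(1)
      by (auto simp: list_all2_conv_all_nth nth_side_rows subset_eq)
    have step: "copy_at (r # c) (graph_of g) (x # ys) \<longleftrightarrow> x < length g \<and> copy_at c (graph_of g) ys \<and>
        (\<forall>i<length c. x \<noteq> ys ! i \<and> adj g x (ys ! i) = r ! i)" (is "?L \<longleftrightarrow> ?R")
    proof (cases "x < length g \<and> length ys = length c \<and> set ys \<subseteq> {..<length g}")
      case True
      then have nth: "i < length c \<Longrightarrow> ys ! i < length g" for i
        by (metis lessThan_iff nth_mem subsetD)
      have "{x, x} \<notin> edges (graph_of g)"
        using True edge_graph_of_iff[of x g x] by simp
      with True nth show ?thesis
        using adj_commute[of g x]
        by (auto simp: copy_at_def All_less_Suc2 edge_graph_of_iff in_set_conv_nth insert_commute)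
    next
      case False
      then show ?thesis by (auto simp: copy_at_def)
    qed
    show ?thesis
      unfolding Cons step places.simps IH
      using row assms(1) by (auto simp: copy_at_def)
  qed
qed

text \<open>
  Each vertex of the pattern that is still to be placed has a domain, the characteristic list of
  the places that are left to it. Placing a vertex at \<open>m\<close> confines each domain to the neighbours or
  to the non-neighbours of \<open>m\<close>. Looking for an empty domain before the recursive call is what keeps
  the search trees small.
\<close>

fun meet :: "bool list \<Rightarrow> bool list \<Rightarrow> bool list" where
  "meet (True # d) (p # ps) = p # meet d ps"
| "meet (False # d) (p # ps) = False # meet d ps"
| "meet _ _ = []"

fun restrict :: "bool list \<Rightarrow> row \<Rightarrow> bool list list \<Rightarrow> bool list list" where
  "restrict (True # r) (p, q) (d # D) = meet d p # restrict r (p, q) D"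
| "restrict (False # r) (p, q) (d # D) = meet d q # restrict r (p, q) D"
| "restrict _ _ _ = []"

definition viable :: "bool list list \<Rightarrow> bool" where
  "viable D \<longleftrightarrow> (\<forall>d\<in>set D. True \<in> set d)"

primrec search :: "row list \<Rightarrow> code \<Rightarrow> bool list list \<Rightarrow> bool" where
  "search M [] D = True"
| "search M (r # c) D = (\<exists>(b, m)\<in>set (zip (hd D) M).
     b \<and> viable (restrict r m (tl D)) \<and> search M c (restrict r m (tl D)))"

definition chosen :: "bool list list \<Rightarrow> nat list \<Rightarrow> bool" where
  "chosen D xs \<longleftrightarrow> list_all2 (\<lambda>d x. x < length d \<and> d ! x) D xs"

lemma length_meet: "length (meet d p) = min (length d) (length p)"
  by (induction d p rule: meet.induct) auto

lemma nth_meet: "\<lbrakk>i < length d; i < length p\<rbrakk> \<Longrightarrow> meet d p ! i \<longleftrightarrow> d ! i \<and> p ! i"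
  by (induction d p arbitrary: i rule: meet.induct) (auto simp: nth_Cons split: nat.split)

lemma restrict_conv: "restrict r m D = map2 (\<lambda>b d. meet d (side b m)) r D"
  by (induction r m D rule: restrict.induct) (auto simp: side_def)

lemma chosen_restrict:
  assumes "length r = length D" "\<And>b. length (side b m) = n" "\<forall>d\<in>set D. length d = n"
  shows "chosen (restrict r m D) xs \<longleftrightarrow>
    chosen D xs \<and> list_all2 (\<lambda>b y. side b m ! y) r xs"
  using assms
  by (auto simp: chosen_def list_all2_conv_all_nth restrict_conv length_meet nth_meet)

lemma chosen_imp_viable: "chosen D xs \<Longrightarrow> viable D"
  unfolding viable_def
proof
  fix d assume "chosen D xs" "d \<in> set D"
  then obtain i where "d = D ! i" "xs ! i < length d" "d ! (xs ! i)"
    by (auto simp: chosen_def list_all2_conv_all_nth in_set_conv_nth)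
  then show "True \<in> set d" using nth_mem by fastforce
qed

lemma bex_zip_iff:
  "length xs = length ys \<Longrightarrow>
    (\<exists>(x, y)\<in>set (zip xs ys). P x y) \<longleftrightarrow> (\<exists>i<length ys. P (xs ! i) (ys ! i))"
  by (auto simp: set_zip)

text \<open>
  A branch that is cut off because a domain is empty contains no solution, since a solution
  picks an element of each domain; so the test for viability changes nothing but the effort.
\<close>

lemma search_iff:
  assumes "well_formed c" "length D = length c" "\<forall>d\<in>set D. length d = length M"
    "\<forall>m\<in>set M. \<forall>b. length (side b m) = length M"
  shows "search M c D \<longleftrightarrow> (\<exists>xs. places M c xs \<and> chosen D xs)"
  using assms(1-3)
proof (induction c arbitrary: D)
  case Nil
  have "places M [] [] \<and> chosen D []" using Nil by (simp add: chosen_def)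
  then show ?case by (metis search.simps(1))
next
  case (Cons r c)
  from Cons.prems obtain d E where D: "D = d # E" by (cases D) auto
  have side: "length (side b (M ! i)) = length M" if "i < length M" for b i
    using assms(4) that by simp
  have IH: "search M c (restrict r (M ! i) E) \<longleftrightarrow>
      (\<exists>xs. places M c xs \<and> chosen E xs \<and> list_all2 (\<lambda>b y. side b (M ! i) ! y) r xs)"
    if "i < length M" for i
  proof -
    have *: "length (restrict r (M ! i) E) = length c"
      "\<forall>d\<in>set (restrict r (M ! i) E). length d = length M"
      using Cons.prems side[OF that] D
      by (auto simp: restrict_conv length_meet set_zip)
    show ?thesis
      using Cons.prems Cons.IH[OF _ *] chosen_restrict[of r E "M ! i" "length M"] side[OF that] D
      by auto
  qed
  have viable: "viable (restrict r (M ! i) E)" if "i < length M" "search M c (restrict r (M ! i) E)" for i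
  proof -
    from that IH obtain xs where "chosen E xs" "list_all2 (\<lambda>b y. side b (M ! i) ! y) r xs" by auto
    then have "chosen (restrict r (M ! i) E) xs"
      using chosen_restrict[of r E "M ! i" "length M" xs] side[OF that(1)] Cons.prems D by simp
    then show ?thesis by (rule chosen_imp_viable)
  qed
  have "search M (r # c) D \<longleftrightarrow> (\<exists>i<length M. d ! i \<and> viable (restrict r (M ! i) E) \<and>
      search M c (restrict r (M ! i) E))"
    using Cons.prems(3) D by (simp add: bex_zip_iff)
  also have "\<dots> \<longleftrightarrow> (\<exists>i<length M. d ! i \<and> search M c (restrict r (M ! i) E))"
    using viable by blast
  also have "\<dots> \<longleftrightarrow> (\<exists>i<length M. d ! i \<and>
      (\<exists>xs. places M c xs \<and> chosen E xs \<and> list_all2 (\<lambda>b y. side b (M ! i) ! y) r xs))"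
    using IH by auto
  also have "\<dots> \<longleftrightarrow> (\<exists>xs. places M (r # c) xs \<and> chosen D xs)" (is "?L \<longleftrightarrow> ?R")
  proof
    assume ?L
    then obtain i xs where "i < length M" "d ! i" "places M c xs" "chosen E xs"
      "list_all2 (\<lambda>b y. side b (M ! i) ! y) r xs" by auto
    then have "places M (r # c) (i # xs) \<and> chosen D (i # xs)"
      using D Cons.prems(3) by (simp add: chosen_def)
    then show ?R ..
  next
    assume ?R
    then obtain xs where xs: "places M (r # c) xs" "chosen D xs" by auto
    then obtain i ys where "xs = i # ys" using places_imp by (cases xs) auto
    then show ?L using xs D by (auto simp: chosen_def)
  qed
  finally show ?case .
qed

definition domains :: "code \<Rightarrow> row list \<Rightarrow> bool list list" where
  "domains c M = map (\<lambda>_. map (\<lambda>_. True) M) c"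

lemma chosen_domains:
  "chosen (domains c M) xs \<longleftrightarrow> length xs = length c \<and> set xs \<subseteq> {..<length M}"
proof -
  have "chosen (domains c M) xs \<longleftrightarrow> length xs = length c \<and> (\<forall>i<length xs. xs ! i < length M)"
    by (auto simp: chosen_def domains_def list_all2_conv_all_nth)
  also have "(\<forall>i<length xs. xs ! i < length M) \<longleftrightarrow> set xs \<subseteq> {..<length M}"
    by (simp add: all_set_conv_all_nth subset_eq)
  finally show ?thesis .
qed

lemma search_domains_iff:
  assumes "well_formed c" "well_formed g"
  shows "search (rows g) c (domains c (rows g)) \<longleftrightarrow> (\<exists>xs. copy_at c (graph_of g) xs)"
proof -
  have "search (rows g) c (domains c (rows g)) \<longleftrightarrow>
      (\<exists>xs. places (rows g) c xs \<and> chosen (domains c (rows g)) xs)"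
    using assms
    by (intro search_iff) (auto simp: domains_def length_side_rows all_set_conv_all_nth)
  also have "\<dots> \<longleftrightarrow> (\<exists>xs. places (rows g) c xs)"
    by (auto simp: chosen_domains dest: places_imp)
  finally show ?thesis using assms by (simp add: places_rows_iff)
qed


section \<open>Certifying deletion saturation\<close>

text \<open>
  A rooted pattern is a code whose vertices \<open>0\<close> and \<open>1\<close> are joined. This root edge is the one
  that is to be deleted.
\<close>

fun cut :: "code \<Rightarrow> code" where
  "cut ((b # r) # c) = (False # r) # c"
| "cut c = c"

definition rooted :: "code \<Rightarrow> bool" where
  "rooted k \<longleftrightarrow> well_formed k \<and> (\<exists>r s c. k = (True # r) # s # c)"

text \<open>
  The only pair of entries of the copy that makes up the deleted edge is the pair of the first two,
  because the entries are distinct.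
\<close>

lemma copy_cut_delete_edge:
  assumes "well_formed ((True # r) # s # c)" "copy_at ((True # r) # s # c) G (a # b # xs)"
  shows "copy_at (cut ((True # r) # s # c)) (delete_edge G {a, b}) (a # b # xs)"
proof -
  let ?k = "(True # r) # s # c" and ?ys = "a # b # xs"
  have "{?ys ! i, ?ys ! j} \<in> edges (delete_edge G {a, b}) \<longleftrightarrow> adj (cut ?k) i j"
    if ij: "i < length ?k" "j < length ?k" for i j
  proof -
    have d: "distinct ?ys" "length ?ys = length ?k" using assms(2) by (auto simp: copy_at_def)
    have eq: "?ys ! i = ?ys ! 0 \<longleftrightarrow> i = 0" "?ys ! i = ?ys ! 1 \<longleftrightarrow> i = 1"
      "?ys ! j = ?ys ! 0 \<longleftrightarrow> j = 0" "?ys ! j = ?ys ! 1 \<longleftrightarrow> j = 1"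
      using d ij by (subst nth_eq_iff_index_eq; force)+
    have "{?ys ! i, ?ys ! j} = {a, b} \<longleftrightarrow> i = 0 \<and> j = 1 \<or> i = 1 \<and> j = 0"
      using eq by (simp add: doubleton_eq_iff)
    moreover have "{?ys ! i, ?ys ! j} \<in> edges G \<longleftrightarrow> adj ?k i j"
      using assms(2) ij unfolding copy_at_def by blast
    moreover have "adj (cut ?k) i j \<longleftrightarrow> adj ?k i j \<and> \<not> (i = 0 \<and> j = 1 \<or> i = 1 \<and> j = 0)"
      by (cases i; cases j) (auto simp: nth_Cons split: nat.split)
    ultimately show ?thesis by (simp add: delete_edge_def)
  qed
  then show ?thesis
    using assms(2) unfolding copy_at_def by (simp add: delete_edge_def)
qed

text \<open>
  A search for a copy whose first two vertices have prescribed rows \<open>m\<close> and \<open>m'\<close>. It starts where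
  the general search would be after these two choices, with the domains that they leave.
\<close>

definition edge_copy :: "row list \<Rightarrow> code \<Rightarrow> row \<Rightarrow> row \<Rightarrow> bool" where
  "edge_copy M k m m' \<longleftrightarrow> search M (tl (tl k))
     (restrict (hd (tl k)) m' (restrict (tl (hd k)) m (domains (tl (tl k)) M)))"

lemma edge_copyD:
  assumes "well_formed g" "well_formed ((True # r) # s # c)"
    "edge_copy (rows g) ((True # r) # s # c) (rows g ! a) (rows g ! b)"
    "a < length g" "b < length g" "adj g a b"
  shows "\<exists>xs. copy_at ((True # r) # s # c) (graph_of g) (a # b # xs)"
proof -
  let ?M = "rows g" and ?D = "domains c (rows g)"
  have len: "length (side q (?M ! i)) = length g" if "i < length g" for q i
    using that assms(1) by (rule length_side_rows[rotated])
  have D: "length r = length ?D" "length s = length ?D" "\<forall>d\<in>set ?D. length d = length g"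
    using assms(1,2) by (auto simp: domains_def)
  have R: "length (restrict r (?M ! a) ?D) = length c"
    "\<forall>d\<in>set (restrict r (?M ! a) ?D). length d = length g"
    using assms(2) D len[OF assms(4)] by (auto simp: restrict_conv length_meet set_zip)
  have S: "length (restrict s (?M ! b) (restrict r (?M ! a) ?D)) = length c"
    "\<forall>d\<in>set (restrict s (?M ! b) (restrict r (?M ! a) ?D)). length d = length g"
    using assms(2) R len[OF assms(5)] by (auto simp: restrict_conv[of s] length_meet set_zip)
  have "search ?M c (restrict s (?M ! b) (restrict r (?M ! a) ?D))"
    using assms(3) by (simp add: edge_copy_def)
  then obtain xs where xs: "places ?M c xs"
    "chosen (restrict s (?M ! b) (restrict r (?M ! a) ?D)) xs"
    using search_iff[OF _ S(1), of ?M] S(2) assms(1,2) len by (auto simp: all_set_conv_all_nth)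
  have "list_all2 (\<lambda>q y. side q (?M ! b) ! y) s xs \<and> list_all2 (\<lambda>q y. side q (?M ! a) ! y) r xs"
    using xs(2) chosen_restrict[of s "restrict r (?M ! a) ?D" "?M ! b" "length g" xs]
      chosen_restrict[of r ?D "?M ! a" "length g" xs] R D len assms(2,4,5) by simp
  then have "places ?M ((True # r) # s # c) (a # b # xs)"
    using xs(1) assms by (auto simp: nth_side_rows)
  then show ?thesis using places_rows_iff[OF assms(1,2)] by blast
qed

text \<open>An edge may serve as root edge in either direction.\<close>

definition covered :: "row list \<Rightarrow> code \<Rightarrow> row \<Rightarrow> row \<Rightarrow> bool" where
  "covered M k m m' \<longleftrightarrow> edge_copy M k m m' \<or> edge_copy M k m' m"

text \<open>
  The edges of \<open>g\<close> are enumerated by running through its code and its rows in parallel, with the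
  rows standing for the vertices; so no vertex number has to be compared or looked up.
\<close>

fun row_edges :: "(row \<Rightarrow> row \<Rightarrow> bool) \<Rightarrow> row \<Rightarrow> bool list \<Rightarrow> row list \<Rightarrow> bool" where
  "row_edges P m (True # r) (m' # M) = (P m m' \<and> row_edges P m r M)"
| "row_edges P m (False # r) (m' # M) = row_edges P m r M"
| "row_edges P m _ _ = True"

fun all_edges :: "(row \<Rightarrow> row \<Rightarrow> bool) \<Rightarrow> row list \<Rightarrow> code \<Rightarrow> bool" where
  "all_edges P (m # M) (r # g) = (row_edges P m r M \<and> all_edges P M g)"
| "all_edges P _ _ = True"

lemma row_edgesD:
  "\<lbrakk>row_edges P m r M; i < length r; i < length M; r ! i\<rbrakk> \<Longrightarrow> P m (M ! i)"
  by (induction P m r M arbitrary: i rule: row_edges.induct)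
    (auto simp: nth_Cons split: nat.splits)

lemma all_edgesD:
  "\<lbrakk>all_edges P M g; well_formed g; length M = length g; i < j; j < length g; adj g i j\<rbrakk>
    \<Longrightarrow> P (M ! i) (M ! j)"
proof (induction P M g arbitrary: i j rule: all_edges.induct)
  case (1 P m M r g)
  then obtain j' where j: "j = Suc j'" by (cases j) auto
  show ?case
  proof (cases i)
    case 0
    then show ?thesis using 1 j row_edgesD[of P m r M j'] by simp
  next
    case (Suc i')
    then show ?thesis using 1 j by simp
  qed
qed auto

fun has_edge :: "code \<Rightarrow> bool" where
  "has_edge [] = False"
| "has_edge ([] # g) = has_edge g"
| "has_edge ((True # r) # g) = True"
| "has_edge ((False # r) # g) = has_edge (r # g)"

lemma has_edge_iff: "has_edge g \<longleftrightarrow> (\<exists>r\<in>set g. True \<in> set r)"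
  by (induction g rule: has_edge.induct) auto

lemma edges_graph_of_nonempty:
  assumes "well_formed g" "has_edge g"
  shows "edges (graph_of g) \<noteq> {}"
proof -
  have "\<exists>i<length g. \<exists>j<length g. adj g i j"
    using assms unfolding has_edge_iff
  proof (induction g)
    case (Cons r g)
    show ?case
    proof (cases "True \<in> set r")
      case True
      then obtain j where "j < length r" "r ! j" by (metis in_set_conv_nth)
      then have "adj (r # g) 0 (Suc j)" "Suc j < length (r # g)" using Cons.prems by auto
      then show ?thesis by (metis length_greater_0_conv list.distinct(1))
    next
      case False
      then obtain i j where "i < length g" "j < length g" "adj g i j"
        using Cons by auto
      then have "adj (r # g) (Suc i) (Suc j)" "Suc i < length (r # g)" "Suc j < length (r # g)"
        by auto
      then show ?thesis by blast
    qed
  qed simp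
  then show ?thesis by (auto simp: graph_of_def)
qed

definition certified :: "row list \<Rightarrow> code \<Rightarrow> code \<Rightarrow> bool" where
  "certified M g k \<longleftrightarrow> rooted k \<and> \<not> search M (cut k) (domains (cut k) M) \<and>
     all_edges (covered M k) M g"

definition host :: "code \<Rightarrow> code list \<Rightarrow> bool" where
  "host g ks \<longleftrightarrow> well_formed g \<and> has_edge g \<and> list_all (certified (rows g) g) ks"

lemma well_formed_cut: "well_formed k \<Longrightarrow> well_formed (cut k)"
  by (induction k rule: cut.induct) auto

text \<open>
  The criterion for saturation: a copy of \<open>k\<close> with root edge \<open>e\<close> turns into a copy of \<open>cut k\<close> when
  \<open>e\<close> is deleted.
\<close>

lemma host_saturated:
  assumes "host g ks" "k \<in> set ks"
  shows "deletion_saturated (graph_of (cut k)) (graph_of g)"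
proof -
  have g: "well_formed g" "has_edge g" and k: "certified (rows g) g k"
    using assms by (auto simp: host_def list_all_iff)
  from k obtain r s c where k_eq: "k = (True # r) # s # c" and wk: "well_formed k"
    by (auto simp: certified_def rooted_def)
  have "\<not> induced_free (graph_of (cut k)) (delete_edge (graph_of g) e)"
    if "e \<in> edges (graph_of g)" for e
  proof -
    obtain i j where e: "e = {i, j}" "i < j" "j < length g" "adj g i j"
      using \<open>e \<in> edges (graph_of g)\<close> by (rule edges_graph_of_cases)
    have "all_edges (covered (rows g) k) (rows g) g" using k by (simp add: certified_def)
    then have "covered (rows g) k (rows g ! i) (rows g ! j)"
      using g(1) length_rows[OF g(1)] e(2-4) by (rule all_edgesD)
    then obtain a b where "e = {a, b}" "a < length g" "b < length g" "adj g a b"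
      "edge_copy (rows g) k (rows g ! a) (rows g ! b)"
      using e adj_commute[of g i j] insert_commute[of i j "{}"]
      unfolding covered_def by (metis order_less_trans)
    then obtain xs where "copy_at (cut k) (delete_edge (graph_of g) e) (a # b # xs)"
      using edge_copyD[of g r s c a b] copy_cut_delete_edge[of r s c "graph_of g" a b] g wk k_eq
      by blast
    then show ?thesis using not_induced_free_iff_copy by blast
  qed
  moreover have "induced_free (graph_of (cut k)) (graph_of g)"
    using k search_domains_iff[OF well_formed_cut[OF wk] g(1)] not_induced_free_iff_copy
    unfolding certified_def by blast
  ultimately show ?thesis
    using edges_graph_of_nonempty[OF g] simple_graph_of by (simp add: deletion_saturated_def)
qed

section \<open>Enumerating the graphs on at most six vertices\<close>

definition all_rows :: "code \<Rightarrow> bool list list" where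
  "all_rows c = foldr (\<lambda>_ R. map ((#) True) R @ map ((#) False) R) c [[]]"

lemma all_rows_simps:
  "all_rows [] = [[]]"
  "all_rows (s # c) = map ((#) True) (all_rows c) @ map ((#) False) (all_rows c)"
  by (simp_all add: all_rows_def)

lemma mem_all_rows: "length r = length c \<Longrightarrow> r \<in> set (all_rows c)"
proof (induction c arbitrary: r)
  case (Cons s c)
  then obtain b r' where "r = b # r'" "length r' = length c" by (auto simp: length_Suc_conv)
  then show ?case using Cons.IH[of r'] by (cases b) (auto simp: all_rows_simps)
qed (simp add: all_rows_simps)

text \<open>
  To find the form of a given graph quickly, the forms are sorted by their number of edges into 16
  buckets, as a graph on six vertices has at most 15 edges. The number of edges is never computed:
  each \<open>True\<close> in the concatenated rows moves on to the next bucket. The forms found in a bucket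
  are checked afterwards, so all that has to be proved about the table is that it contains
  nothing but forms.
\<close>

fun enter :: "bool list \<Rightarrow> code \<Rightarrow> code list list \<Rightarrow> code list list" where
  "enter [] c (B # Bs) = (c # B) # Bs"
| "enter (True # w) c (B # Bs) = B # enter w c Bs"
| "enter (False # w) c Bs = enter w c Bs"
| "enter w c [] = []"

fun bucket :: "bool list \<Rightarrow> code list list \<Rightarrow> code list" where
  "bucket [] (B # Bs) = B"
| "bucket (True # w) (B # Bs) = bucket w Bs"
| "bucket (False # w) Bs = bucket w Bs"
| "bucket w [] = []"

primrec table :: "code list \<Rightarrow> code list list" where
  "table [] = [[], [], [], [], [], [], [], [], [], [], [], [], [], [], [], []]"
| "table (c # cs) = enter (concat c) c (table cs)"

lemma set_enter: "B \<in> set (enter w c Bs) \<Longrightarrow> set B \<subseteq> insert c (\<Union> (set ` set Bs))"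
  by (induction w c Bs rule: enter.induct) auto

lemma set_bucket: "set (bucket w Bs) \<subseteq> \<Union> (set ` set Bs)"
  by (induction w Bs rule: bucket.induct) auto

lemma set_table: "\<Union> (set ` set (table cs)) \<subseteq> set cs"
proof (induction cs)
  case (Cons c cs)
  then show ?case using set_enter[of _ "concat c" c "table cs"] by fastforce
qed simp

definition matches :: "row list \<Rightarrow> code \<Rightarrow> code list \<Rightarrow> bool" where
  "matches M c B \<longleftrightarrow> (\<exists>f\<in>set B. length f = length c \<and> search M f (domains f M))"

text \<open>
  A copy of one graph in another with the same number of vertices is an isomorphism, so the search
  for copies also serves to recognise the form of an extended graph.
\<close>

definition known :: "code list list \<Rightarrow> code \<Rightarrow> bool list \<Rightarrow> bool" where
  "known T c r \<longleftrightarrow> matches (rows (r # c)) (r # c) (bucket (concat (r # c)) T)"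

definition closed_at :: "code list list \<Rightarrow> code \<Rightarrow> bool" where
  "closed_at T c \<longleftrightarrow> (length c < 6 \<longrightarrow> list_all (known T c) (all_rows c))"

definition closed :: "code list \<Rightarrow> bool" where
  "closed fs \<longleftrightarrow> list_all well_formed fs \<and> list_all (closed_at (table fs)) fs"

lemma closed_extension:
  assumes "closed fs" "c \<in> set fs" "length c < 6" "length r = length c"
  obtains f where "f \<in> set fs" "length f = length (r # c)"
    "isomorphic (graph_of (r # c)) (graph_of f)"
proof -
  have "known (table fs) c r"
    using assms mem_all_rows by (auto simp: closed_def closed_at_def list_all_iff)
  then obtain f where f: "f \<in> set (bucket (concat (r # c)) (table fs))" "length f = length (r # c)"
    "search (rows (r # c)) f (domains f (rows (r # c)))"
    by (auto simp: known_def matches_def simp del: rows.simps)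
  have fs: "f \<in> set fs"
    using f(1) set_bucket set_table by blast
  have "well_formed f" "well_formed (r # c)"
    using assms fs by (auto simp: closed_def list_all_iff)
  then obtain xs where "copy_at f (graph_of (r # c)) xs"
    using f(3) search_domains_iff by blast
  then show thesis
    using that fs f(2) copy_spanning_isomorphic by blast
qed

text \<open>
  An isomorphism between \<open>H - v\<close> and the graph of \<open>c\<close> extends to \<open>H\<close> if \<open>v\<close> becomes the vertex \<open>0\<close>,
  with the neighbours of \<open>v\<close> transported along the isomorphism as its row.
\<close>

lemma isomorphic_graph_of_Cons:
  assumes "simple_graph H" "v \<in> vertices H" "well_formed c"
    "isomorphic (induced_subgraph H (vertices H - {v})) (graph_of c)"
  obtains r where "length r = length c" "isomorphic H (graph_of (r # c))"
proof -
  let ?W = "vertices H - {v}"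
  obtain f where f: "bij_betw f ?W {..<length c}"
    and E: "\<And>x y. x \<in> ?W \<Longrightarrow> y \<in> ?W \<Longrightarrow> {x, y} \<in> edges H \<longleftrightarrow> {f x, f y} \<in> edges (graph_of c)"
    using assms(4) by (auto simp: isomorphic_def induced_subgraph_def)
  define r where "r = map (\<lambda>i. {v, inv_into ?W f i} \<in> edges H) [0..<length c]"
  have loop: "{x} \<notin> edges H" for x
    using assms(1) by (auto simp: simple_graph_def)
  have fW: "f x < length c" if "x \<in> ?W" for x
    using f that by (auto simp: bij_betw_def)
  have E': "{x, y} \<in> edges H \<longleftrightarrow> adj c (f x) (f y)" if "x \<in> ?W" "y \<in> ?W" for x y
    using E[OF that] fW that by (simp add: edge_graph_of_iff)
  have r: "r ! f x \<longleftrightarrow> {v, x} \<in> edges H" if "x \<in> ?W" for x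
    using f fW[OF that] that by (simp add: r_def bij_betw_inv_into_left)
  define h where "h x = (if x = v then 0 else Suc (f x))" for x
  have "bij_betw h (vertices H) {..<length (r # c)}"
    unfolding bij_betw_def
  proof
    show "inj_on h (vertices H)"
      using f by (auto simp: h_def inj_on_def bij_betw_def)
    have "h ` vertices H = insert 0 (Suc ` f ` ?W)"
      using assms(2) by (auto simp: h_def image_iff)
    also have "f ` ?W = {..<length c}" using f by (simp add: bij_betw_def)
    also have "insert 0 (Suc ` {..<length c}) = {..<length (r # c)}"
      by (simp add: lessThan_Suc_eq_insert_0)
    finally show "h ` vertices H = {..<length (r # c)}" .
  qed
  moreover have "{x, y} \<in> edges H \<longleftrightarrow> {h x, h y} \<in> edges (graph_of (r # c))"
    if "x \<in> vertices H" "y \<in> vertices H" for x y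
  proof -
    have "h x < length (r # c)" "h y < length (r # c)"
      using that fW by (auto simp: h_def)
    then have "{h x, h y} \<in> edges (graph_of (r # c)) \<longleftrightarrow> adj (r # c) (h x) (h y)"
      by (rule edge_graph_of_iff)
    also have "\<dots> \<longleftrightarrow> {x, y} \<in> edges H"
      using that r[of x] r[of y] E'[of x y] loop[of v] insert_commute[of v x "{}"]
      by (auto simp: h_def)
    finally show ?thesis by simp
  qed
  ultimately have "isomorphic H (graph_of (r # c))"
    unfolding isomorphic_def by auto
  moreover have "length r = length c" by (simp add: r_def)
  ultimately show thesis using that by blast
qed

lemma closed_represents:
  fixes H :: "'a ugraph"
  assumes "closed fs" "[[]] \<in> set fs"
    and "simple_graph H" "card (vertices H) = Suc n" "Suc n \<le> 6"
  shows "\<exists>f\<in>set fs. length f = Suc n \<and> isomorphic H (graph_of f)"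
  using assms(3-5)
proof (induction n arbitrary: H)
  case 0
  then obtain v where v: "vertices H = {v}" by (auto simp: card_Suc_eq)
  have "{v} \<notin> edges H" using 0 by (auto simp: simple_graph_def)
  then have "isomorphic H (graph_of [[]])"
    using v unfolding isomorphic_def
    by (intro exI[of _ "\<lambda>_. 0"]) (auto simp: bij_betw_def graph_of_def adj.simps)
  then show ?case using assms(2) by (intro bexI[of _ "[[]]"]) auto
next
  case (Suc n)
  then obtain v where v: "v \<in> vertices H" by (metis card.empty ex_in_conv nat.distinct(1))
  let ?H = "induced_subgraph H (vertices H - {v})"
  have "simple_graph ?H" "card (vertices ?H) = Suc n"
    using Suc.prems v by (auto simp: simple_graph_def induced_subgraph_def)
  then obtain c where c: "c \<in> set fs" "length c = Suc n" "isomorphic ?H (graph_of c)"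
    using Suc.IH Suc.prems by fastforce
  have wc: "well_formed c" using assms(1) c(1) by (simp add: closed_def list_all_iff)
  obtain r where r: "length r = length c" "isomorphic H (graph_of (r # c))"
    by (rule isomorphic_graph_of_Cons[OF Suc.prems(1) v wc c(3)])
  have "length c < 6" using c(2) Suc.prems(3) by simp
  with assms(1) c(1) obtain f where f: "f \<in> set fs" "length f = length (r # c)"
    "isomorphic (graph_of (r # c)) (graph_of f)"
    using r(1) by (rule closed_extension)
  have "isomorphic H (graph_of f)" by (rule isomorphic_trans[OF r(2) f(3)])
  then show ?case using f c(2) by (intro bexI[of _ f]) simp_all
qed

section \<open>Evaluation by rewriting\<close>

text \<open>
  The searches are carried out by the simplifier. It normalises the arguments of a function before
  it rewrites the application, so the two sides of a disjunction would both be evaluated, although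
  the second one is pointless after the first has turned out true, and likewise for
  conjunctions. Each such decision is therefore delegated to an auxiliary
  function that takes the first truth value, already evaluated, as an argument, and the ingredients
  of the second one as data; its equations distinguish the cases of that argument. Compared with
  conditional expressions this has the further advantage that no congruence rule is involved, which
  would make the simplifier traverse the rows of the graph again and again.
\<close>

definition scan :: "row list \<Rightarrow> bool list \<Rightarrow> code \<Rightarrow> bool list list \<Rightarrow> bool list \<Rightarrow> row list \<Rightarrow> bool" where
  "scan M r c D d N \<longleftrightarrow> (\<exists>(b, m)\<in>set (zip d N).
     b \<and> viable (restrict r m D) \<and> search M c (restrict r m D))"

definition probe :: "bool \<Rightarrow> row list \<Rightarrow> code \<Rightarrow> bool list list \<Rightarrow> bool" where
  "probe v M c D \<longleftrightarrow> v \<and> search M c D"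

definition descend :: "row list \<Rightarrow> code \<Rightarrow> bool list list \<Rightarrow> bool" where
  "descend M c D = probe (viable D) M c D"

definition retry ::
  "bool \<Rightarrow> row list \<Rightarrow> bool list \<Rightarrow> code \<Rightarrow> bool list list \<Rightarrow> bool list \<Rightarrow> row list \<Rightarrow> bool" where
  "retry found M r c D d N \<longleftrightarrow> found \<or> scan M r c D d N"

definition swap_ends :: "bool \<Rightarrow> row list \<Rightarrow> code \<Rightarrow> row \<Rightarrow> row \<Rightarrow> bool" where
  "swap_ends found M k m m' \<longleftrightarrow> found \<or> edge_copy M k m' m"

definition attempt :: "bool \<Rightarrow> row list \<Rightarrow> code \<Rightarrow> code \<Rightarrow> code list \<Rightarrow> bool" where
  "attempt fits M c f B \<longleftrightarrow> fits \<and> search M f (domains f M) \<or> matches M c B"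

definition resume :: "bool \<Rightarrow> row list \<Rightarrow> code \<Rightarrow> code list \<Rightarrow> bool" where
  "resume found M c B \<longleftrightarrow> found \<or> matches M c B"

lemma viable_eval:
  "viable [] = True"
  "viable ([] # D) = False"
  "viable ((True # d) # D) = viable D"
  "viable ((False # d) # D) = viable (d # D)"
  by (auto simp: viable_def)

lemma search_eval:
  "search M [] D = True"
  "search M (r # c) (d # D) = scan M r c D d M"
  "scan M r c D [] N = False"
  "scan M r c D (False # d) (m # N) = scan M r c D d N"
  "scan M r c D (True # d) (m # N) = retry (descend M c (restrict r m D)) M r c D d N"
  "descend M c D = probe (viable D) M c D"
  "probe True M c D = search M c D"
  "probe False M c D = False"
  "retry True M r c D d N = True"
  "retry False M r c D d N = scan M r c D d N"
  by (auto simp: scan_def retry_def descend_def probe_def)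

lemma edge_copy_eval:
  "edge_copy M (r # s # c) m m' = search M c (restrict s m' (restrict (tl r) m (domains c M)))"
  "covered M k m m' = swap_ends (edge_copy M k m m') M k m m'"
  "swap_ends True M k m m' = True"
  "swap_ends False M k m m' = edge_copy M k m' m"
  by (auto simp: edge_copy_def covered_def swap_ends_def)

lemma rooted_eval: "rooted ((True # r) # s # c) = well_formed ((True # r) # s # c)"
  by (simp add: rooted_def)

lemma matches_eval:
  "matches M c (f # B) = attempt (length f = length c) M c f B"
  "attempt True M c f B = resume (search M f (domains f M)) M c B"
  "attempt False M c f B = matches M c B"
  "resume True M c B = True"
  "resume False M c B = matches M c B"
  by (auto simp: matches_def attempt_def resume_def)

text \<open>Matching on the shape of a code replaces the comparison of its length with six.\<close>

lemma closed_at_eval: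
  "closed_at T [a] = list_all (known T [a]) (all_rows [a])"
  "closed_at T [a, b] = list_all (known T [a, b]) (all_rows [a, b])"
  "closed_at T [a, b, c] = list_all (known T [a, b, c]) (all_rows [a, b, c])"
  "closed_at T [a, b, c, d] = list_all (known T [a, b, c, d]) (all_rows [a, b, c, d])"
  "closed_at T [a, b, c, d, e] = list_all (known T [a, b, c, d, e]) (all_rows [a, b, c, d, e])"
  "closed_at T (a # b # c # d # e # f # g) = True"
  by (simp_all add: closed_at_def)

lemmas boolean_eval = simp_thms nat.inject length_Cons list.size(3)
  old.nat.distinct list.pred_inject list.map list.sel append.simps concat.simps

lemmas graph_eval = rows.simps attach.simps well_formed.simps domains_def
  meet.simps restrict.simps viable_eval search_eval

lemmas host_eval = boolean_eval graph_eval host_def certified_def cut.simps rooted_eval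
  has_edge.simps all_edges.simps row_edges.simps edge_copy_eval

lemmas closed_eval = boolean_eval graph_eval closed_def known_def closed_at_eval matches_eval
  all_rows_simps table.simps enter.simps bucket.simps cut.simps

section \<open>The saturated graphs\<close>

abbreviation (input) T where "T \<equiv> True"
abbreviation (input) F where "F \<equiv> False"

text \<open>
  Each host is followed by the rooted patterns that it serves. For several patterns other hosts on
  the list would do as well; they are listed with the one for which the search is shortest, and
  the order of their vertices after the root edge is chosen with the same aim.
\<close>

definition single_edge :: code where
  "single_edge =
    [[T], []]"

definition single_edge_patterns :: "code list" where
  "single_edge_patterns =
    [[[T], []]]"

lemma host_single_edge: "host single_edge single_edge_patterns"
  by (simp only: single_edge_def single_edge_patterns_def host_eval)

definition triangle_and_vertex :: code where
  "triangle_and_vertex =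
    [[T,T,F], [T,F], [F], []]"

definition triangle_and_vertex_patterns :: "code list" where
  "triangle_and_vertex_patterns =
    [[[T,F], [F], []],
     [[T,T], [T], []],
     [[T,T,F], [T,F], [F], []]]"

lemma host_triangle_and_vertex: "host triangle_and_vertex triangle_and_vertex_patterns"
  by (simp only: triangle_and_vertex_def triangle_and_vertex_patterns_def host_eval)

definition edge_and_three_vertices :: code where
  "edge_and_three_vertices =
    [[T,F,F,F], [F,F,F], [F,F], [F], []]"

definition edge_and_three_vertices_patterns :: "code list" where
  "edge_and_three_vertices_patterns =
    [[[T,F,F,F], [F,F,F], [F,F], [F], []]]"

lemma host_edge_and_three_vertices: "host edge_and_three_vertices edge_and_three_vertices_patterns"
  by (simp only: edge_and_three_vertices_def edge_and_three_vertices_patterns_def host_eval)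

definition edge_and_four_vertices :: code where
  "edge_and_four_vertices =
    [[T,F,F,F,F], [F,F,F,F], [F,F,F], [F,F], [F], []]"

definition edge_and_four_vertices_patterns :: "code list" where
  "edge_and_four_vertices_patterns =
    [[[T,F,F,F,F], [F,F,F,F], [F,F,F], [F,F], [F], []]]"

lemma host_edge_and_four_vertices: "host edge_and_four_vertices edge_and_four_vertices_patterns"
  by (simp only: edge_and_four_vertices_def edge_and_four_vertices_patterns_def host_eval)

definition star_5 :: code where
  "star_5 =
    [[T,T,T,T,T], [F,F,F,F], [F,F,F], [F,F], [F], []]"

definition star_5_patterns :: "code list" where
  "star_5_patterns =
    [[[T,T], [F], []],
     [[T,T,T,T], [F,F,F], [F,F], [F], []],
     [[T,T,T,T,T], [F,F,F,F], [F,F,F], [F,F], [F], []]]"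

lemma host_star_5: "host star_5 star_5_patterns"
  by (simp only: star_5_def star_5_patterns_def host_eval)

definition two_triangles_and_vertex :: code where
  "two_triangles_and_vertex =
    [[T,T,F,F,F,F], [T,F,F,F,F], [F,F,F,F], [F,F,F], [T,T], [T], []]"

definition two_triangles_and_vertex_patterns :: "code list" where
  "two_triangles_and_vertex_patterns =
    [[[T,F,F], [F,F], [F], []],
     [[T,F,F,F], [F,F,F], [T,F], [F], []],
     [[T,T,F,F], [T,F,F], [F,F], [F], []],
     [[T,T,F,F], [T,F,F], [F,F], [T], []],
     [[T,F,F,F,F], [F,F,F,F], [T,T,F], [T,F], [F], []],
     [[T,T,F,F,F], [T,F,F,F], [F,F,F], [T,F], [F], []],
     [[T,T,F,F,F], [T,F,F,F], [F,F,F], [T,T], [T], []]]"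

lemma host_two_triangles_and_vertex: "host two_triangles_and_vertex two_triangles_and_vertex_patterns"
  by (simp only: two_triangles_and_vertex_def two_triangles_and_vertex_patterns_def host_eval)

definition two_K4 :: code where
  "two_K4 =
    [[F,T,F,T,F,T,F], [F,T,F,T,F,T], [F,T,F,T,F], [F,T,F,T], [F,T,F], [F,T], [F], []]"

definition two_K4_patterns :: "code list" where
  "two_K4_patterns =
    [[[T,F,F], [F,F], [T], []],
     [[T,T,T], [T,T], [T], []],
     [[T,F,F,F], [F,F,F], [T,T], [T], []],
     [[T,T,T,F], [T,T,F], [T,F], [F], []],
     [[T,F,F,F,F], [F,F,F,F], [T,T,T], [T,T], [T], []],
     [[T,F,T,T,F], [F,T,T,F], [F,F,T], [T,F], [F], []]]"

lemma host_two_K4: "host two_K4 two_K4_patterns"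
  by (simp only: two_K4_def two_K4_patterns_def host_eval)

definition tripartite_3_3_3 :: code where
  "tripartite_3_3_3 =
    [[T,T,F,T,T,F,T,T], [T,T,F,T,T,F,T], [T,T,F,T,T,F], [T,T,F,T,T], [T,T,F,T], [T,T,F], [T,T], [T],
     []]"

definition tripartite_3_3_3_patterns :: "code list" where
  "tripartite_3_3_3_patterns =
    [[[T,F,T], [T,F], [T], []],
     [[T,T,T], [T,F], [T], []],
     [[T,F,T,T], [T,F,F], [T,T], [F], []],
     [[T,T,T,T], [T,F,F], [T,T], [F], []],
     [[T,T,F,T], [T,T,F], [T,T], [T], []],
     [[T,T,T,T], [F,T,T], [T,T], [F], []],
     [[T,F,F,T,T], [T,T,F,F], [F,T,T], [T,T], [F], []],
     [[T,T,F,T,T], [T,T,F,F], [T,T,T], [T,T], [F], []],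
     [[T,T,T,T,T], [T,T,F,F], [F,T,T], [T,T], [F], []],
     [[T,T,T,T,T], [F,T,T,T], [T,T,T], [F,F], [F], []],
     [[T,F,T,T,T], [T,F,T,T], [T,T,T], [T,T], [F], []]]"

lemma host_tripartite_3_3_3: "host tripartite_3_3_3 tripartite_3_3_3_patterns"
  by (simp only: tripartite_3_3_3_def tripartite_3_3_3_patterns_def host_eval)

definition cone_over_2_2_2_2 :: code where
  "cone_over_2_2_2_2 =
    [[T,T,T,T,T,T,T,T], [F,T,T,T,T,T,T], [T,T,T,T,T,T], [F,T,T,T,T], [T,T,T,T], [F,T,T], [T,T], [F],
     []]"

definition cone_over_2_2_2_2_patterns :: "code list" where
  "cone_over_2_2_2_2_patterns =
    [[[T,T,T,T], [T,T,F], [T,T], [T], []],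
     [[T,T,T,T,T], [T,F,T,T], [T,T,T], [T,T], [F], []],
     [[T,T,T,T,T], [T,T,T,F], [T,T,T], [T,T], [T], []]]"

lemma host_cone_over_2_2_2_2: "host cone_over_2_2_2_2 cone_over_2_2_2_2_patterns"
  by (simp only: cone_over_2_2_2_2_def cone_over_2_2_2_2_patterns_def host_eval)

text \<open>This is also the complement of the Petersen graph.\<close>

definition line_K5 :: code where
  "line_K5 =
    [[T,F,F,T,F,T,T,T,T], [T,F,F,T,F,T,T,T], [T,F,T,T,F,T,T], [T,T,T,T,F,T], [T,T,T,T,F], [F,T,T,F],
     [F,T,T], [F,T], [F], []]"

definition line_K5_patterns :: "code list" where
  "line_K5_patterns =
    [[[T,F,T], [F,T], [T], []],
     [[T,F,T], [T,F], [F], []],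
     [[T,F,F,T], [F,T,F], [T,T], [F], []],
     [[T,T,F,T], [F,F,T], [T,T], [F], []],
     [[T,F,T,T], [T,F,T], [F,T], [F], []],
     [[T,T,T,T], [F,F,T], [T,T], [T], []],
     [[T,F,T,T], [F,T,T], [T,T], [T], []],
     [[T,F,T,T], [T,F,T], [F,T], [T], []],
     [[T,T,F,F,T], [F,F,T,F], [T,T,T], [T,T], [F], []],
     [[T,T,T,T,F], [F,F,T,F], [T,T,T], [T,T], [F], []],
     [[T,T,F,T,T], [F,F,T,F], [T,T,T], [T,T], [F], []],
     [[T,F,T,T,F], [T,F,T,F], [F,T,T], [T,T], [F], []],
     [[T,F,T,F,T], [T,F,F,T], [T,T,T], [T,T], [F], []],
     [[T,F,T,F,T], [F,T,T,F], [T,T,T], [T,F], [F], []],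
     [[T,T,F,T,T], [F,F,T,T], [T,F,T], [T,F], [F], []],
     [[T,T,F,T,T], [F,F,T,T], [T,T,T], [T,F], [F], []],
     [[T,F,T,F,T], [T,F,F,T], [T,T,T], [T,T], [T], []],
     [[T,F,T,T,T], [F,T,T,T], [T,T,F], [T,F], [F], []],
     [[T,F,T,F,T], [T,F,T,F], [F,T,T], [T,T], [F], []],
     [[T,F,T,T,T], [T,T,T,F], [F,T,F], [T,T], [F], []],
     [[T,F,F,T,T], [T,T,T,F], [T,T,F], [F,T], [F], []],
     [[T,F,T,T,T], [T,F,T,T], [F,T,T], [T,F], [F], []],
     [[T,F,T,T,T], [T,F,F,T], [T,F,T], [T,T], [T], []],
     [[T,T,T,T,T], [F,F,T,T], [T,T,T], [T,F], [F], []],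
     [[T,F,T,T,T], [T,F,T,T], [T,F,T], [F,T], [T], []],
     [[T,T,T,T,T], [F,T,T,T], [T,T,F], [F,F], [T], []]]"

lemma host_line_K5: "host line_K5 line_K5_patterns"
  by (simp only: line_K5_def line_K5_patterns_def host_eval)

text \<open>An automorphism rotates each of three successive blocks of three vertices and fixes
the last vertex.\<close>

definition rotation_10 :: code where
  "rotation_10 =
    [[F,F,F,T,T,F,T,T,T], [F,T,F,T,T,F,T,T], [T,T,F,T,T,F,T], [F,F,F,T,T,T], [F,T,F,T,T], [T,T,F,T],
     [T,T,F], [T,F], [F], []]"

definition rotation_10_patterns :: "code list" where
  "rotation_10_patterns =
    [[[T,F,T,T], [F,T,T], [T,T], [F], []],
     [[T,F,T,T,T], [F,T,F,T], [T,T,T], [T,F], [F], []],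
     [[T,F,T,T,T], [T,T,F,T], [T,T,F], [F,F], [T], []]]"

lemma host_rotation_10: "host rotation_10 rotation_10_patterns"
  by (simp only: rotation_10_def rotation_10_patterns_def host_eval)

definition paley_13 :: code where
  "paley_13 =
    [[T,F,T,T,F,F,F,F,T,T,F,T], [T,F,T,T,F,F,F,F,T,T,F], [T,F,T,T,F,F,F,F,T,T], [T,F,T,T,F,F,F,F,T],
     [T,F,T,T,F,F,F,F], [T,F,T,T,F,F,F], [T,F,T,T,F,F], [T,F,T,T,F], [T,F,T,T], [T,F,T], [T,F], [T],
     []]"

definition paley_13_patterns :: "code list" where
  "paley_13_patterns =
    [[[T,F,T,F], [F,F,F], [F,T], [F], []],
     [[T,F,F,T], [T,T,F], [T,F], [F], []],
     [[T,F,F,F,T], [F,F,F,F], [T,F,F], [T,F], [T], []],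
     [[T,F,F,F,T], [F,F,T,F], [F,T,T], [F,F], [T], []],
     [[T,F,T,F,T], [F,T,F,F], [T,F,T], [F,F], [F], []],
     [[T,F,T,F,T], [F,F,F,F], [F,F,T], [T,T], [T], []],
     [[T,F,F,T,T], [F,F,F,F], [T,T,F], [F,F], [T], []],
     [[T,F,T,F,T], [F,F,F,F], [F,T,T], [F,T], [T], []],
     [[T,F,F,F,F], [T,T,F,F], [F,F,T], [T,F], [T], []],
     [[T,F,F,F,T], [F,T,F,F], [F,F,T], [T,F], [F], []],
     [[T,F,T,F,F], [F,F,T,F], [F,T,F], [T,T], [F], []],
     [[T,F,F,F,T], [F,F,T,F], [F,T,T], [T,F], [F], []],
     [[T,F,F,T,F], [F,F,T,F], [T,T,F], [T,T], [F], []],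
     [[T,F,T,T,F], [F,T,T,F], [F,T,F], [F,T], [F], []],
     [[T,F,F,F,T], [F,F,T,F], [F,T,T], [T,T], [T], []],
     [[T,F,T,F,F], [F,F,T,F], [F,T,T], [F,F], [F], []],
     [[T,F,T,T,F], [F,F,F,T], [F,T,F], [T,F], [F], []],
     [[T,F,F,T,F], [F,F,T,T], [T,T,F], [T,T], [T], []],
     [[T,F,F,T,T], [F,F,T,F], [T,T,T], [T,T], [F], []],
     [[T,F,T,F,T], [T,F,F,F], [F,F,F], [T,F], [T], []],
     [[T,F,T,T,T], [F,T,T,F], [T,T,F], [F,F], [F], []],
     [[T,F,T,T,F], [F,T,F,T], [T,T,F], [T,T], [F], []],
     [[T,F,T,F,T], [F,F,T,T], [F,T,T], [T,F], [F], []],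
     [[T,F,F,T,T], [F,F,T,T], [T,T,F], [T,T], [F], []],
     [[T,F,T,T,F], [F,T,F,T], [T,T,T], [F,F], [F], []],
     [[T,F,F,T,T], [T,T,F,F], [T,T,F], [T,F], [T], []]]"

lemma host_paley_13: "host paley_13 paley_13_patterns"
  by (simp only: paley_13_def paley_13_patterns_def host_eval)

definition icosahedron_cone :: code where
  "icosahedron_cone =
    [[F,T,F,T,F,T,T,F,F,F,T,T], [F,T,F,T,T,T,T,F,F,F,T], [F,T,F,F,T,T,T,F,F,T], [F,T,F,F,T,T,T,F,T],
     [F,F,F,F,T,T,T,T], [T,F,F,F,T,T,T], [T,F,F,F,T,T], [T,F,F,F,T], [T,F,F,T], [T,F,T], [T,T], [T],
     []]"

definition icosahedron_cone_patterns :: "code list" where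
  "icosahedron_cone_patterns =
    [[[T,T,T], [T,T], [F], []],
     [[T,T,F,T], [T,T,T], [T,F], [F], []],
     [[T,T,T,T], [T,T,T], [T,F], [T], []],
     [[T,T,F,F,T], [T,T,T,T], [T,F,F], [T,F], [T], []],
     [[T,T,T,F,T], [T,T,T,T], [T,T,F], [T,T], [F], []]]"

lemma host_icosahedron_cone: "host icosahedron_cone icosahedron_cone_patterns"
  by (simp only: icosahedron_cone_def icosahedron_cone_patterns_def host_eval)

text \<open>An automorphism rotates each of four successive blocks of three vertices and fixes
the last vertex.\<close>

definition rotation_13 :: code where
  "rotation_13 =
    [[T,T,T,F,T,T,T,F,T,T,F,F], [T,T,T,F,F,T,T,F,T,T,F], [F,T,T,T,F,T,T,F,T,F], [T,T,F,T,T,F,T,T,T],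
     [T,T,F,T,T,F,T,T], [T,T,F,T,T,F,T], [F,F,F,T,T,T], [F,T,F,T,T], [T,T,F,T], [F,F,T], [F,T], [T],
     []]"

definition rotation_13_patterns :: "code list" where
  "rotation_13_patterns =
    [[[T,F,T,T,F], [T,F,T,T], [F,T,T], [F,T], [T], []]]"

lemma host_rotation_13: "host rotation_13 rotation_13_patterns"
  by (simp only: rotation_13_def rotation_13_patterns_def host_eval)

text \<open>An automorphism rotates each of two successive blocks of seven vertices.\<close>

definition bicirculant_14 :: code where
  "bicirculant_14 =
    [[T,F,F,F,F,T,F,T,T,F,F,T,T], [T,F,F,F,F,T,F,T,T,F,F,T], [T,F,F,F,T,T,F,T,T,F,F],
     [T,F,F,F,T,T,F,T,T,F], [T,F,F,F,T,T,F,T,T], [T,T,F,F,T,T,F,T], [T,T,F,F,T,T,F], [F,T,T,T,T,F],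
     [F,T,T,T,T], [F,T,T,T], [F,T,T], [F,T], [F], []]"

definition bicirculant_14_patterns :: "code list" where
  "bicirculant_14_patterns =
    [[[T,F,T,F,T], [F,F,T,T], [T,T,F], [F,F], [F], []]]"

lemma host_bicirculant_14: "host bicirculant_14 bicirculant_14_patterns"
  by (simp only: bicirculant_14_def bicirculant_14_patterns_def host_eval)

definition line_K6 :: code where
  "line_K6 =
    [[F,T,T,F,F,F,T,F,T,T,T,T,T,F], [F,T,T,T,F,F,T,F,F,T,T,T,T], [F,T,F,T,F,F,T,T,F,T,T,T],
     [F,T,F,T,F,F,T,T,F,T,T], [F,T,F,T,F,T,T,T,F,T], [T,T,T,T,F,F,F,T,T], [T,T,T,T,F,F,F,T],
     [T,T,T,T,F,F,F], [T,F,T,T,F,F], [F,F,T,T,F], [T,F,F,T], [T,F,F], [T,F], [T], []]"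

definition line_K6_patterns :: "code list" where
  "line_K6_patterns =
    [[[T,F,F,T], [F,T,F], [F,F], [T], []],
     [[T,F,T,T], [F,T,F], [F,F], [T], []],
     [[T,T,T,T], [F,F,F], [T,T], [T], []],
     [[T,T,T,T], [T,T,T], [T,T], [T], []],
     [[T,F,F,T,F], [F,F,F,F], [T,T,T], [T,T], [F], []],
     [[T,F,T,T,F], [F,F,F,F], [F,T,T], [T,T], [F], []],
     [[T,F,T,F,T], [F,T,T,F], [F,F,F], [T,T], [T], []],
     [[T,F,T,T,T], [F,F,T,T], [F,F,F], [T,T], [F], []],
     [[T,F,T,T,T], [F,F,F,F], [T,T,F], [T,T], [T], []],
     [[T,F,F,T,F], [F,F,T,F], [T,T,T], [T,T], [F], []],
     [[T,F,F,T,F], [F,T,F,F], [T,T,T], [T,F], [F], []],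
     [[T,F,F,F,T], [F,F,T,F], [T,F,T], [T,F], [F], []],
     [[T,F,F,F,T], [F,T,T,F], [T,F,F], [T,F], [T], []],
     [[T,F,T,T,F], [F,T,F,F], [T,T,T], [T,F], [F], []],
     [[T,F,T,T,T], [F,F,F,T], [T,F,F], [T,F], [T], []],
     [[T,F,T,T,T], [F,F,T,F], [T,F,F], [T,T], [T], []],
     [[T,F,T,F,T], [F,T,F,F], [T,T,T], [T,F], [F], []],
     [[T,F,F,T,T], [F,T,T,F], [T,F,F], [F,F], [T], []],
     [[T,F,F,T,T], [F,T,T,F], [T,F,F], [T,F], [T], []],
     [[T,F,T,T,T], [F,T,T,F], [T,F,F], [F,F], [T], []],
     [[T,F,T,T,T], [F,T,T,F], [T,F,F], [T,F], [T], []],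
     [[T,F,T,T,F], [F,T,F,F], [T,T,T], [T,T], [T], []],
     [[T,F,T,F,T], [F,T,T,F], [T,T,F], [F,F], [F], []],
     [[T,F,T,F,T], [F,T,T,F], [T,T,F], [T,F], [F], []],
     [[T,F,T,T,T], [F,T,T,F], [T,T,F], [T,F], [F], []],
     [[T,F,T,T,T], [F,T,T,T], [T,F,F], [T,F], [F], []],
     [[T,T,T,T,T], [F,F,F,T], [T,T,T], [T,F], [F], []],
     [[T,T,T,T,T], [F,F,T,F], [T,T,T], [T,T], [T], []],
     [[T,F,T,F,T], [F,T,F,T], [T,T,F], [T,F], [F], []],
     [[T,F,T,T,F], [F,T,T,F], [T,F,T], [T,F], [T], []],
     [[T,F,T,T,F], [F,T,T,F], [T,T,T], [T,T], [F], []],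
     [[T,F,F,T,T], [T,T,T,F], [T,T,F], [T,F], [T], []],
     [[T,T,T,T,T], [T,T,T,F], [T,T,T], [T,F], [F], []],
     [[T,T,T,T,T], [T,T,T,T], [F,T,T], [F,F], [T], []]]"

lemma host_line_K6: "host line_K6 line_K6_patterns"
  by (simp only: line_K6_def line_K6_patterns_def host_eval)

definition line_petersen :: code where
  "line_petersen =
    [[T,F,F,T,T,F,F,F,T,F,F,F,F,F], [T,F,F,T,T,F,F,F,F,F,F,F,F], [T,F,F,T,T,F,F,F,F,F,F,F],
     [T,F,F,T,T,F,F,F,F,F,F], [F,F,F,T,T,F,F,F,F,F], [F,F,F,F,T,F,T,F,F], [F,F,F,F,T,F,T,F],
     [F,F,F,F,T,F,T], [F,T,F,F,T,F], [F,T,F,F,T], [F,T,T,F], [F,T,T], [F,T], [F], []]"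

definition line_petersen_patterns :: "code list" where
  "line_petersen_patterns =
    [[[T,T,F,T], [T,F,F], [T,F], [F], []],
     [[T,T,F,F], [T,F,F], [T,T], [T], []],
     [[T,F,F,F,F], [F,F,F,F], [F,T,F], [F,F], [F], []],
     [[T,T,F,F,F], [T,F,F,F], [T,F,F], [F,F], [F], []],
     [[T,T,F,T,F], [T,F,F,F], [T,F,F], [F,F], [F], []],
     [[T,T,F,F,F], [T,F,F,F], [T,T,F], [T,F], [F], []],
     [[T,T,F,F,F], [T,F,F,F], [F,F,T], [T,F], [F], []],
     [[T,T,T,T,F], [T,F,F,F], [F,F,T], [T,F], [F], []],
     [[T,T,F,F,T], [T,F,T,F], [T,F,F], [F,F], [F], []],
     [[T,T,F,F,T], [T,F,F,F], [T,T,F], [T,F], [F], []],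
     [[T,T,F,F,T], [T,F,F,F], [T,F,F], [T,F], [T], []],
     [[T,T,T,F,F], [F,F,T,T], [T,F,F], [F,F], [T], []]]"

lemma host_line_petersen: "host line_petersen line_petersen_patterns"
  by (simp only: line_petersen_def line_petersen_patterns_def host_eval)

text \<open>The pairs in a six-element set, joined if they are disjoint. This is also the
collinearity graph of the generalized quadrangle of order two, and the complement of the line
graph of \<open>K\<^sub>6\<close>.\<close>

definition kneser_6_2 :: code where
  "kneser_6_2 =
    [[T,F,F,T,T,F,T,T,F,T,F,F,F,F], [T,F,F,F,T,F,T,T,F,T,F,F,F], [T,F,T,F,T,F,T,F,F,T,F,F],
     [T,T,T,F,T,F,F,F,F,T,F], [F,T,T,F,T,F,F,F,F,T], [F,F,F,F,T,T,F,F,T], [F,F,F,T,T,T,F,F],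
     [F,F,F,T,T,T,F], [F,F,F,T,T,T], [T,F,F,T,T], [F,T,T,F], [F,T,T], [F,T], [F], []]"

definition kneser_6_2_patterns :: "code list" where
  "kneser_6_2_patterns =
    [[[T,T,T], [F,F], [T], []],
     [[T,F,T,F], [F,T,F], [T,F], [T], []],
     [[T,F,T,T,F], [F,F,F,F], [F,F,F], [F,F], [F], []],
     [[T,F,F,F,F], [F,F,F,F], [T,F,F], [F,F], [T], []],
     [[T,F,T,F,T], [F,F,F,F], [F,F,F], [T,F], [T], []],
     [[T,T,F,T,F], [F,F,F,F], [T,F,T], [T,F], [T], []],
     [[T,F,T,T,F], [F,T,F,F], [T,F,F], [F,T], [F], []],
     [[T,F,T,F,F], [F,T,F,F], [T,T,F], [T,T], [F], []],
     [[T,F,T,T,F], [F,T,F,F], [T,T,F], [F,T], [T], []]]"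

lemma host_kneser_6_2: "host kneser_6_2 kneser_6_2_patterns"
  by (simp only: kneser_6_2_def kneser_6_2_patterns_def host_eval)

text \<open>The five vertices and ten edges of \<open>K\<^sub>5\<close>: two vertices are
joined, two edges are joined if they share an end, and a vertex is joined to the edges that
avoid it.\<close>

definition vertices_and_edges_K5 :: code where
  "vertices_and_edges_K5 =
    [[T,F,F,T,T,T,F,F,T,F,T,T,T,T], [T,F,F,T,T,T,F,F,T,F,T,T,T], [T,F,F,T,T,T,F,T,T,F,T,T],
     [T,F,F,T,T,T,T,T,T,F,T], [T,F,F,T,T,T,T,T,T,F], [T,T,T,T,T,F,T,T,F], [T,T,T,F,T,F,T,T],
     [T,T,T,F,T,F,T], [T,T,T,F,T,F], [F,T,T,F,T], [F,T,T,F], [F,T,T], [F,T], [F], []]"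

definition vertices_and_edges_K5_patterns :: "code list" where
  "vertices_and_edges_K5_patterns =
    [[[T,T,F,T,T], [T,F,T,T], [F,T,T], [F,F], [T], []],
     [[T,F,F,F,T], [F,T,T,F], [T,T,T], [T,F], [F], []],
     [[T,T,F,T,T], [T,F,T,T], [F,T,F], [F,T], [F], []],
     [[T,T,T,F,T], [F,F,F,T], [T,T,T], [T,T], [T], []],
     [[T,T,F,T,T], [F,T,T,F], [F,T,T], [F,F], [T], []],
     [[T,F,T,F,T], [F,T,T,F], [F,T,T], [F,F], [T], []],
     [[T,F,T,T,F], [T,F,T,F], [F,T,T], [T,T], [T], []],
     [[T,F,T,T,T], [F,T,T,F], [T,T,T], [T,T], [T], []],
     [[T,T,F,F,T], [F,T,T,F], [F,T,T], [T,F], [F], []],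
     [[T,T,T,T,T], [F,F,T,T], [T,T,T], [T,T], [T], []],
     [[T,F,T,T,T], [F,T,T,T], [T,T,T], [T,T], [T], []],
     [[T,F,T,T,T], [T,F,T,T], [F,T,T], [T,T], [T], []]]"

lemma host_vertices_and_edges_K5: "host vertices_and_edges_K5 vertices_and_edges_K5_patterns"
  by (simp only: vertices_and_edges_K5_def vertices_and_edges_K5_patterns_def host_eval)

text \<open>An automorphism rotates each of two successive blocks of seven vertices and fixes
the last vertex.\<close>

definition rotation_15 :: code where
  "rotation_15 =
    [[F,F,T,T,F,F,F,T,T,F,T,F,F,F], [F,F,T,T,F,F,F,T,T,F,T,F,F], [F,F,T,T,F,F,F,T,T,F,T,F],
     [F,F,T,T,F,F,F,T,T,F,F], [F,F,F,T,F,F,F,T,T,F], [F,T,F,T,F,F,F,T,F], [T,T,F,T,F,F,F,F],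
     [F,T,F,F,T,F,T], [F,T,F,F,T,T], [F,T,F,F,T], [F,T,F,T], [F,T,T], [F,T], [T], []]"

definition rotation_15_patterns :: "code list" where
  "rotation_15_patterns =
    [[[T,T,T,F,F], [F,F,T,F], [T,F,F], [F,F], [F], []],
     [[T,F,F,T,F], [T,F,F,F], [F,F,F], [F,T], [F], []],
     [[T,T,F,T,F], [T,F,F,F], [T,T,T], [F,T], [F], []]]"

lemma host_rotation_15: "host rotation_15 rotation_15_patterns"
  by (simp only: rotation_15_def rotation_15_patterns_def host_eval)

text \<open>An automorphism rotates each of three successive blocks of five vertices and fixes
the last vertex.\<close>

definition rotation_16 :: code where
  "rotation_16 =
    [[F,T,T,F,T,T,F,T,T,T,T,F,T,T,F], [F,T,T,T,T,T,F,T,T,T,T,F,T,F], [F,T,T,T,T,T,F,T,T,T,T,F,F],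
     [F,F,T,T,T,T,F,T,T,T,T,F], [T,F,T,T,T,T,F,T,T,T,F], [F,T,T,F,F,T,F,F,T,T], [F,T,T,T,F,T,F,F,T],
     [F,T,F,T,F,T,F,T], [F,F,F,T,F,T,T], [T,F,F,T,F,T], [F,T,T,F,T], [F,T,T,T], [F,T,T], [F,T], [T],
     []]"

definition rotation_16_patterns :: "code list" where
  "rotation_16_patterns =
    [[[T,F,T,T,T], [F,T,T,T], [T,T,T], [T,F], [T], []]]"

lemma host_rotation_16: "host rotation_16 rotation_16_patterns"
  by (simp only: rotation_16_def rotation_16_patterns_def host_eval)

text \<open>The tensor product of \<open>K\<^sub>3\<close> and \<open>K\<^sub>5\<close>, with an
isolated vertex.\<close>

definition tensor_K3_K5_and_vertex :: code where
  "tensor_K3_K5_and_vertex =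
    [[F,F,F,F,F,T,T,T,T,F,T,T,T,T,F], [F,F,F,T,F,T,T,T,T,F,T,T,T,F], [F,F,T,T,F,T,T,T,T,F,T,T,F],
     [F,T,T,T,F,T,T,T,T,F,T,F], [T,T,T,T,F,T,T,T,T,F,F], [F,F,F,F,F,T,T,T,T,F], [F,F,F,T,F,T,T,T,F],
     [F,F,T,T,F,T,T,F], [F,T,T,T,F,T,F], [T,T,T,T,F,F], [F,F,F,F,F], [F,F,F,F], [F,F,F], [F,F], [F],
     []]"

definition tensor_K3_K5_and_vertex_patterns :: "code list" where
  "tensor_K3_K5_and_vertex_patterns =
    [[[T,T,F,T], [F,T,F], [T,T], [T], []],
     [[T,F,T,T], [T,T,F], [F,T], [F], []],
     [[T,F,F,F,T], [F,F,T,F], [F,F,F], [F,F], [T], []],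
     [[T,T,F,T,F], [F,F,F,F], [F,T,F], [T,F], [F], []],
     [[T,F,F,F,F], [T,F,T,T], [F,T,F], [F,F], [T], []],
     [[T,F,T,F,F], [F,F,T,T], [T,F,F], [T,T], [F], []],
     [[T,F,T,F,F], [F,T,T,T], [T,F,F], [T,T], [F], []],
     [[T,F,T,T,F], [T,T,F,T], [T,T,T], [T,F], [T], []],
     [[T,F,T,T,T], [F,T,T,T], [T,T,T], [F,F], [F], []]]"

lemma host_tensor_K3_K5_and_vertex: "host tensor_K3_K5_and_vertex tensor_K3_K5_and_vertex_patterns"
  by (simp only: tensor_K3_K5_and_vertex_def tensor_K3_K5_and_vertex_patterns_def host_eval)

text \<open>An automorphism rotates each of two successive blocks of eight vertices.\<close>

definition bicirculant_16 :: code where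
  "bicirculant_16 =
    [[T,T,T,F,T,T,T,T,F,F,F,F,T,F,T], [T,T,T,F,T,T,T,T,F,F,F,F,T,F], [T,T,T,F,T,F,T,T,F,F,F,F,T],
     [T,T,T,F,T,F,T,T,F,F,F,F], [T,T,T,F,T,F,T,T,F,F,F], [T,T,F,F,T,F,T,T,F,F], [T,F,F,F,T,F,T,T,F],
     [F,F,F,F,T,F,T,T], [T,T,T,F,T,T,T], [T,T,T,F,T,T], [T,T,T,F,T], [T,T,T,F], [T,T,T], [T,T], [T],
     []]"

definition bicirculant_16_patterns :: "code list" where
  "bicirculant_16_patterns =
    [[[T,F,F,F], [T,F,T], [T,F], [T], []],
     [[T,F,F,F,F], [T,T,F,T], [T,T,F], [T,T], [T], []],
     [[T,F,F,F,T], [F,T,F,F], [F,T,T], [T,T], [F], []],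
     [[T,F,F,T,F], [T,T,T,F], [F,T,T], [F,T], [F], []],
     [[T,F,F,F,T], [T,F,T,T], [T,F,T], [T,T], [T], []],
     [[T,T,T,T,T], [T,T,F,T], [F,T,T], [T,F], [T], []]]"

lemma host_bicirculant_16: "host bicirculant_16 bicirculant_16_patterns"
  by (simp only: bicirculant_16_def bicirculant_16_patterns_def host_eval)

text \<open>The complement of the rook graph of the four by four board.\<close>

definition rook_complement :: code where
  "rook_complement =
    [[T,F,T,T,T,F,T,F,F,T,F,T,T,F,T], [T,F,T,T,T,F,F,F,F,T,T,T,T,F], [T,F,T,T,T,T,F,F,F,F,T,T,T],
     [T,F,T,T,F,T,F,F,T,F,T,T], [T,F,T,T,T,F,T,F,F,T,F], [T,F,T,T,T,F,F,F,F,T], [T,F,T,T,T,T,F,F,F],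
     [T,F,T,T,F,T,F,F], [T,F,T,T,T,F,T], [T,F,T,T,T,F], [T,F,T,T,T], [T,F,T,T], [T,F,T], [T,F], [T],
     []]"

definition rook_complement_patterns :: "code list" where
  "rook_complement_patterns =
    [[[T,F,T,T,T], [F,T,T,F], [T,T,F], [F,T], [T], []],
     [[T,F,T,T,F], [F,T,T,F], [T,T,T], [T,T], [T], []],
     [[T,F,F,T,T], [T,T,F,F], [T,T,T], [T,T], [T], []]]"

lemma host_rook_complement: "host rook_complement rook_complement_patterns"
  by (simp only: rook_complement_def rook_complement_patterns_def host_eval)

definition icosahedron_join_K6 :: code where
  "icosahedron_join_K6 =
    [[F,T,F,T,F,T,T,T,T,T,T,F,T,T,T,F,F], [F,T,F,T,T,T,T,T,T,T,F,F,T,T,T,F],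
     [F,T,F,T,T,T,T,T,T,F,F,F,T,T,T], [F,T,T,T,T,T,T,T,T,F,F,F,T,T], [F,T,T,T,T,T,T,T,T,F,F,F,T],
     [T,T,T,T,T,T,T,T,T,F,F,F], [T,T,T,T,T,T,T,T,T,T,T], [T,T,T,T,T,T,T,T,T,T], [T,T,T,T,T,T,T,T,T],
     [T,T,T,T,T,T,T,T], [T,T,T,T,T,T,T], [T,T,T,T,T,T], [T,F,F,F,T], [T,F,F,F], [T,F,F], [T,F], [T],
     []]"

definition icosahedron_join_K6_patterns :: "code list" where
  "icosahedron_join_K6_patterns =
    [[[T,T,T,T,T], [T,T,T,T], [T,T,F], [T,T], [T], []]]"

lemma host_icosahedron_join_K6: "host icosahedron_join_K6 icosahedron_join_K6_patterns"
  by (simp only: icosahedron_join_K6_def icosahedron_join_K6_patterns_def host_eval)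

text \<open>An automorphism rotates each of two successive blocks of ten vertices.\<close>

definition rotation_20 :: code where
  "rotation_20 =
    [[T,T,F,F,F,F,F,T,T,T,T,T,T,F,T,F,T,T,T], [T,T,F,F,F,F,F,T,T,T,T,T,T,F,T,F,T,T],
     [T,T,F,F,F,F,F,T,T,T,T,T,T,F,T,F,T], [T,T,F,F,F,F,T,T,T,T,T,T,T,F,T,F],
     [T,T,F,F,F,F,T,T,T,T,T,T,T,F,T], [T,T,F,F,T,F,T,T,T,T,T,T,T,F], [T,T,F,F,T,F,T,T,T,T,T,T,T],
     [T,T,T,F,T,F,T,T,T,T,T,T], [T,T,T,F,T,F,T,T,T,T,T], [T,T,T,F,T,F,T,T,T,T], [T,F,F,T,T,T,F,F,T],
     [T,F,F,T,T,T,F,F], [T,F,F,T,T,T,F], [T,F,F,T,T,T], [T,F,F,T,T], [T,F,F,T], [T,F,F], [T,F], [T],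
     []]"

definition rotation_20_patterns :: "code list" where
  "rotation_20_patterns =
    [[[T,T,T,T,T], [T,T,T,T], [T,T,F], [F,T], [T], []]]"

lemma host_rotation_20: "host rotation_20 rotation_20_patterns"
  by (simp only: rotation_20_def rotation_20_patterns_def host_eval)

text \<open>The flags of the Fano plane, which are the edges of the Heawood graph; two of them
are joined if their distance in its line graph is at most two.\<close>

definition heawood_flags :: code where
  "heawood_flags =
    [[T,F,T,T,F,T,T,F,T,F,T,F,T,T,F,F,F,T,T,T], [T,F,T,T,F,T,T,F,T,F,T,F,T,T,F,F,F,T,T],
     [T,F,T,T,F,T,T,F,T,F,T,T,T,T,F,F,F,T], [T,F,T,T,F,T,T,F,T,F,T,T,T,T,F,F,F],
     [T,F,F,T,F,T,T,F,T,F,T,T,T,T,F,F], [T,T,F,T,F,T,T,F,F,F,T,T,T,T,F],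
     [F,T,F,T,F,T,T,F,F,F,T,T,T,T], [T,T,F,F,T,T,T,T,F,F,T,T,F], [T,T,F,F,T,F,T,T,F,F,T,T],
     [T,T,F,F,T,F,T,T,F,F,T], [T,T,F,T,T,F,T,T,F,F], [T,T,F,T,T,F,T,T,F], [T,F,F,T,T,F,T,T],
     [T,F,F,T,T,F,T], [F,T,T,T,T,F], [F,T,T,T,T], [F,T,T,T], [F,T,T], [F,T], [F], []]"

definition heawood_flags_patterns :: "code list" where
  "heawood_flags_patterns =
    [[[T,F,F,F,F], [F,F,T,T], [F,T,T], [T,T], [T], []],
     [[T,F,F,T,T], [F,F,F,T], [F,T,T], [T,T], [T], []],
     [[T,F,F,T,T], [F,F,T,T], [F,T,T], [T,T], [F], []],
     [[T,F,F,T,T], [F,F,T,T], [F,T,T], [T,T], [T], []],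
     [[T,F,T,T,T], [T,F,T,T], [F,T,T], [T,T], [F], []],
     [[T,F,T,T,T], [T,T,T,T], [T,T,F], [T,T], [T], []]]"

lemma host_heawood_flags: "host heawood_flags heawood_flags_patterns"
  by (simp only: heawood_flags_def heawood_flags_patterns_def host_eval)

definition line_K7 :: code where
  "line_K7 =
    [[F,F,T,T,F,F,F,T,T,F,F,T,T,F,T,F,T,T,F,T], [F,F,T,T,F,T,F,T,T,F,F,T,T,F,T,F,T,T,F],
     [F,F,T,T,T,T,F,T,T,F,F,F,T,F,T,F,T,T], [F,F,T,F,T,T,F,T,T,F,T,F,T,F,T,F,T],
     [F,F,F,F,T,T,F,T,T,T,T,F,T,F,T,F], [F,T,F,F,T,T,F,T,F,T,T,F,T,F,T],
     [T,T,F,F,T,T,F,T,F,T,T,F,T,F], [T,F,F,F,F,T,F,F,T,T,T,T,F], [T,F,F,F,F,F,F,F,T,T,T,T],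
     [T,F,F,F,T,F,F,F,T,T,T], [T,F,F,T,T,F,F,F,T,T], [T,F,T,T,T,F,F,F,T], [T,T,T,T,T,F,F,F],
     [F,T,T,T,T,F,F], [F,T,F,F,T,F], [F,T,F,F,T], [F,T,F,F], [F,T,F], [F,T], [F], []]"

definition line_K7_patterns :: "code list" where
  "line_K7_patterns =
    [[[T,F,T,T,T], [F,F,F,T], [F,F,F], [T,T], [T], []],
     [[T,T,T,T,T], [F,F,F,F], [T,T,T], [T,T], [T], []],
     [[T,F,T,F,F], [F,T,F,F], [T,T,T], [T,T], [T], []],
     [[T,F,F,F,T], [T,T,T,F], [T,T,F], [T,F], [F], []],
     [[T,T,T,T,T], [T,T,T,F], [T,T,F], [T,F], [F], []],
     [[T,T,T,T,T], [T,T,T,T], [T,T,T], [T,T], [T], []]]"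

lemma host_line_K7: "host line_K7 line_K7_patterns"
  by (simp only: line_K7_def line_K7_patterns_def host_eval)

text \<open>An automorphism rotates each of three successive blocks of seven vertices.\<close>

definition rotation_21 :: code where
  "rotation_21 =
    [[F,F,T,T,F,F,T,T,F,F,F,F,T,T,F,T,F,F,T,F], [F,F,T,T,F,T,T,T,F,F,F,F,F,T,F,T,F,F,T],
     [F,F,T,T,F,T,T,T,F,F,F,T,F,T,F,T,F,F], [F,F,T,F,F,T,T,T,F,F,F,T,F,T,F,T,F],
     [F,F,F,F,F,T,T,T,F,F,F,T,F,T,F,T], [F,F,F,F,F,T,T,T,T,F,F,T,F,T,F],
     [T,F,F,F,F,T,T,F,T,F,F,T,F,T], [F,T,F,F,T,F,T,F,F,T,T,F,F], [F,T,F,F,T,F,T,F,F,T,T,F],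
     [F,T,F,F,F,F,T,F,F,T,T], [F,T,F,T,F,F,T,F,F,T], [F,T,T,T,F,F,T,F,F], [F,F,T,T,F,F,T,F],
     [F,F,T,T,F,F,T], [T,F,F,F,F,T], [T,F,F,F,F], [T,F,F,F], [T,F,F], [T,F], [T], []]"

definition rotation_21_patterns :: "code list" where
  "rotation_21_patterns =
    [[[T,T,F,F,F], [T,F,F,F], [T,T,T], [F,F], [F], []]]"

lemma host_rotation_21: "host rotation_21 rotation_21_patterns"
  by (simp only: rotation_21_def rotation_21_patterns_def host_eval)

lemmas certified_hosts = host_single_edge host_triangle_and_vertex host_edge_and_three_vertices
  host_edge_and_four_vertices host_star_5 host_two_triangles_and_vertex host_two_K4
  host_tripartite_3_3_3 host_cone_over_2_2_2_2 host_line_K5 host_rotation_10 host_paley_13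
  host_icosahedron_cone host_rotation_13 host_bicirculant_14 host_line_K6 host_line_petersen
  host_kneser_6_2 host_vertices_and_edges_K5 host_rotation_15 host_rotation_16
  host_tensor_K3_K5_and_vertex host_bicirculant_16 host_rook_complement host_icosahedron_join_K6
  host_rotation_20 host_heawood_flags host_line_K7 host_rotation_21

definition hosts :: "(code \<times> code list) list" where
  "hosts =
    [(single_edge, single_edge_patterns),
     (triangle_and_vertex, triangle_and_vertex_patterns),
     (edge_and_three_vertices, edge_and_three_vertices_patterns),
     (edge_and_four_vertices, edge_and_four_vertices_patterns),
     (star_5, star_5_patterns),
     (two_triangles_and_vertex, two_triangles_and_vertex_patterns),
     (two_K4, two_K4_patterns),
     (tripartite_3_3_3, tripartite_3_3_3_patterns),
     (cone_over_2_2_2_2, cone_over_2_2_2_2_patterns),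
     (line_K5, line_K5_patterns),
     (rotation_10, rotation_10_patterns),
     (paley_13, paley_13_patterns),
     (icosahedron_cone, icosahedron_cone_patterns),
     (rotation_13, rotation_13_patterns),
     (bicirculant_14, bicirculant_14_patterns),
     (line_K6, line_K6_patterns),
     (line_petersen, line_petersen_patterns),
     (kneser_6_2, kneser_6_2_patterns),
     (vertices_and_edges_K5, vertices_and_edges_K5_patterns),
     (rotation_15, rotation_15_patterns),
     (rotation_16, rotation_16_patterns),
     (tensor_K3_K5_and_vertex, tensor_K3_K5_and_vertex_patterns),
     (bicirculant_16, bicirculant_16_patterns),
     (rook_complement, rook_complement_patterns),
     (icosahedron_join_K6, icosahedron_join_K6_patterns),
     (rotation_20, rotation_20_patterns),
     (heawood_flags, heawood_flags_patterns),
     (line_K7, line_K7_patterns),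
     (rotation_21, rotation_21_patterns)]"

definition patterns :: "code list" where
  "patterns = concat (map snd hosts)"

section \<open>Completeness of the list of patterns\<close>

definition complete_codes :: "code list" where
  "complete_codes =
    [[[]],
     [[T], []],
     [[T,T], [T], []],
     [[T,T,T], [T,T], [T], []],
     [[T,T,T,T], [T,T,T], [T,T], [T], []],
     [[T,T,T,T,T], [T,T,T,T], [T,T,T], [T,T], [T], []]]"

text \<open>
  The forms are the representatives of all isomorphism types on one to six vertices.
\<close>

definition forms :: "code list" where
  "forms = complete_codes @ map cut patterns"

text \<open>
  There is no comparison with an independent list of the graphs on six vertices: closure under adding a
  vertex is itself the proof that none is missing.
\<close>

lemma closed_forms: "closed forms"
  by (simp only: forms_def complete_codes_def patterns_def hosts_def prod.sel
      single_edge_patterns_def triangle_and_vertex_patterns_def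
      edge_and_three_vertices_patterns_def edge_and_four_vertices_patterns_def
      star_5_patterns_def two_triangles_and_vertex_patterns_def two_K4_patterns_def
      tripartite_3_3_3_patterns_def cone_over_2_2_2_2_patterns_def line_K5_patterns_def
      rotation_10_patterns_def paley_13_patterns_def icosahedron_cone_patterns_def
      rotation_13_patterns_def bicirculant_14_patterns_def line_K6_patterns_def
      line_petersen_patterns_def kneser_6_2_patterns_def vertices_and_edges_K5_patterns_def
      rotation_15_patterns_def rotation_16_patterns_def tensor_K3_K5_and_vertex_patterns_def
      bicirculant_16_patterns_def rook_complement_patterns_def icosahedron_join_K6_patterns_def
      rotation_20_patterns_def heawood_flags_patterns_def line_K7_patterns_def
      rotation_21_patterns_def closed_eval)

section \<open>Every non-complete graph on at most six vertices\<close>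

lemma complete_graph_graph_of:
  assumes "well_formed c" "\<forall>r\<in>set c. False \<notin> set r"
  shows "complete_graph (graph_of c)"
proof -
  have "adj c i j" if "i < length c" "j < length c" "i \<noteq> j" for i j
    using assms that
  proof (induction c arbitrary: i j)
    case (Cons r c)
    have "r ! k" if "k < length r" for k
      using Cons.prems(2) nth_mem[OF that] by (metis (full_types) list.set_intros(1))
    then show ?case using Cons by (cases i; cases j) auto
  qed simp
  then show ?thesis by (simp add: complete_graph_def edge_graph_of_iff)
qed

lemma complete_graph_isomorphic:
  assumes "isomorphic H K" "complete_graph K"
  shows "complete_graph H"
proof -
  obtain f where f: "bij_betw f (vertices H) (vertices K)"
    and E: "\<And>u v. u \<in> vertices H \<Longrightarrow> v \<in> vertices H \<Longrightarrow> {u, v} \<in> edges H \<longleftrightarrow> {f u, f v} \<in> edges K"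
    using assms(1) unfolding isomorphic_def by blast
  then show ?thesis
    using assms(2) unfolding complete_graph_def bij_betw_def inj_on_def by (metis imageI)
qed

lemma patterns_saturated:
  assumes "k \<in> set patterns"
  shows "\<exists>g. deletion_saturated (graph_of (cut k)) (graph_of g)"
proof -
  have "\<forall>(g, ks)\<in>set hosts. host g ks"
    by (simp add: hosts_def certified_hosts)
  then show ?thesis
    using assms host_saturated by (fastforce simp: patterns_def)
qed

theorem theorem1p9:
  fixes H :: "'a ugraph"
  assumes "simple_graph H"
    and "\<not> complete_graph H"
    and "card (vertices H) \<le> 6"
  shows "deletion_normal H"
proof -
  have "vertices H \<noteq> {}" using assms(2) by (auto simp: complete_graph_def)
  then have "card (vertices H) > 0"
    using assms(1) by (auto simp: simple_graph_def card_gt_0_iff)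
  then obtain n where n: "card (vertices H) = Suc n"
    using gr0_implies_Suc by blast
  have "[[]] \<in> set forms" by (simp add: forms_def complete_codes_def)
  then obtain f where f: "f \<in> set forms" "isomorphic H (graph_of f)"
    using closed_represents[OF closed_forms _ assms(1) n] assms(3) n by auto
  have "f \<notin> set complete_codes"
  proof
    assume "f \<in> set complete_codes"
    then have "complete_graph (graph_of f)"
      by (intro complete_graph_graph_of) (auto simp: complete_codes_def)
    then show False using complete_graph_isomorphic[OF f(2)] assms(2) by blast
  qed
  then obtain k where "k \<in> set patterns" "f = cut k"
    using f(1) by (auto simp: forms_def)
  then obtain g where "deletion_saturated (graph_of f) (graph_of g)"
    using patterns_saturated by blast
  then have "deletion_saturated H (graph_of g)"
    by (rule deletion_saturated_isomorphic[OF f(2)])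
  then show ?thesis unfolding deletion_normal_def by blast
qed

end
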